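(* Let $k$ be a field and let $C$ be a finitely generated subcategory of the category of finite-dimensional $k$-vector spaces and $k$-linear maps. Then $C$ is residually finite.
   Context: A category is finitely generated if it has only finitely many objects and there is a finite set of morphisms such that every morphism is a finite composition of these morphisms and identity morphisms. Subcategories need not be full. A category $D$ is finite if its collection of objects is finite and all sets $\mathrm{Mor}_D(X,Y)$ are finite. Two morphisms $f\in \mathrm{Mor}_C(X,Y)$, $g\in\mathrm{Mor}_C(X',Y')$ of a category $C$ are considered equal if and only if $X=X'$, $Y=Y'$ and $f=g$. A category $C$ is residually finite if for all morphisms $f,g$ in $C$ with $f\neq g$ there exist a finite category $D$ and a functor $F\colon C\to D$ with $F(f)\neq F(g)$. *)

theory Defs
  imports "Jordan_Normal_Form.Missing_VectorSpace"
begin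

section \<open>Categories with possibly overlapping Hom-sets\<close>

text \<open>
  The sets \<open>Mor C X Y\<close> need not be disjoint, so identities and composition are indexed by
  objects: \<open>Comp C X Y Z g f\<close> is the composite of \<open>f : X \<rightarrow> Y\<close> followed by \<open>g : Y \<rightarrow> Z\<close>.
  The values of \<open>Mor\<close>, \<open>Ident\<close> and \<open>Comp\<close> outside the object set are irrelevant.
\<close>

record ('o, 'a) category =
  Ob :: "'o set"
  Mor :: "'o \<Rightarrow> 'o \<Rightarrow> 'a set"
  Ident :: "'o \<Rightarrow> 'a"
  Comp :: "'o \<Rightarrow> 'o \<Rightarrow> 'o \<Rightarrow> 'a \<Rightarrow> 'a \<Rightarrow> 'a"

locale category =
  fixes C :: "('o, 'a) category"
  assumes Ident_in_Mor: "X \<in> Ob C \<Longrightarrow> Ident C X \<in> Mor C X X"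
    and Comp_in_Mor:
      "\<lbrakk>X \<in> Ob C; Y \<in> Ob C; Z \<in> Ob C; f \<in> Mor C X Y; g \<in> Mor C Y Z\<rbrakk>
        \<Longrightarrow> Comp C X Y Z g f \<in> Mor C X Z"
    and Comp_Ident_right:
      "\<lbrakk>X \<in> Ob C; Y \<in> Ob C; f \<in> Mor C X Y\<rbrakk> \<Longrightarrow> Comp C X X Y f (Ident C X) = f"
    and Comp_Ident_left:
      "\<lbrakk>X \<in> Ob C; Y \<in> Ob C; f \<in> Mor C X Y\<rbrakk> \<Longrightarrow> Comp C X Y Y (Ident C Y) f = f"
    and Comp_assoc:
      "\<lbrakk>W \<in> Ob C; X \<in> Ob C; Y \<in> Ob C; Z \<in> Ob C;
        f \<in> Mor C W X; g \<in> Mor C X Y; h \<in> Mor C Y Z\<rbrakk>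
        \<Longrightarrow> Comp C W Y Z h (Comp C W X Y g f) = Comp C W X Z (Comp C X Y Z h g) f"

text \<open>
  A morphism taken together with its source and target. Equality of such triples is the
  equality of morphisms \<open>f \<in> Mor C X Y\<close> and \<open>g \<in> Mor C X' Y'\<close>: \<open>X = X'\<close>, \<open>Y = Y'\<close> and \<open>f = g\<close>.
\<close>

definition arrows :: "('o, 'a) category \<Rightarrow> ('o \<times> 'o \<times> 'a) set" where
  "arrows C = {(X, Y, f). X \<in> Ob C \<and> Y \<in> Ob C \<and> f \<in> Mor C X Y}"

definition subcategory :: "('o, 'a) category \<Rightarrow> ('o, 'a) category \<Rightarrow> bool" where
  "subcategory C D \<longleftrightarrow>
    category C \<and>
    Ob C \<subseteq> Ob D \<and>
    (\<forall>X\<in>Ob C. \<forall>Y\<in>Ob C. Mor C X Y \<subseteq> Mor D X Y) \<and>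
    (\<forall>X\<in>Ob C. Ident C X = Ident D X) \<and>
    (\<forall>X\<in>Ob C. \<forall>Y\<in>Ob C. \<forall>Z\<in>Ob C. \<forall>f\<in>Mor C X Y. \<forall>g\<in>Mor C Y Z.
      Comp C X Y Z g f = Comp D X Y Z g f)"

inductive_set finite_composites ::
    "('o, 'a) category \<Rightarrow> ('o \<times> 'o \<times> 'a) set \<Rightarrow> ('o \<times> 'o \<times> 'a) set"
  for C :: "('o, 'a) category" and S :: "('o \<times> 'o \<times> 'a) set"
where
  identity: "X \<in> Ob C \<Longrightarrow> (X, X, Ident C X) \<in> finite_composites C S"
| generator: "(X, Y, f) \<in> S \<Longrightarrow> (X, Y, f) \<in> finite_composites C S"
| composite: "\<lbrakk>(X, Y, f) \<in> finite_composites C S; (Y, Z, g) \<in> finite_composites C S\<rbrakk>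
    \<Longrightarrow> (X, Z, Comp C X Y Z g f) \<in> finite_composites C S"

definition finitely_generated_category :: "('o, 'a) category \<Rightarrow> bool" where
  "finitely_generated_category C \<longleftrightarrow>
    finite (Ob C) \<and>
    (\<exists>S. finite S \<and> S \<subseteq> arrows C \<and> arrows C \<subseteq> finite_composites C S)"

definition finite_category :: "('o, 'a) category \<Rightarrow> bool" where
  "finite_category D \<longleftrightarrow>
    category D \<and> finite (Ob D) \<and> (\<forall>X\<in>Ob D. \<forall>Y\<in>Ob D. finite (Mor D X Y))"

definition is_functor ::
    "('o, 'a) category \<Rightarrow> ('p, 'b) category \<Rightarrow> ('o \<Rightarrow> 'p) \<Rightarrow> ('o \<Rightarrow> 'o \<Rightarrow> 'a \<Rightarrow> 'b) \<Rightarrow> bool" where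
  "is_functor C D F\<^sub>0 F\<^sub>1 \<longleftrightarrow>
    (\<forall>X\<in>Ob C. F\<^sub>0 X \<in> Ob D) \<and>
    (\<forall>X\<in>Ob C. \<forall>Y\<in>Ob C. \<forall>f\<in>Mor C X Y. F\<^sub>1 X Y f \<in> Mor D (F\<^sub>0 X) (F\<^sub>0 Y)) \<and>
    (\<forall>X\<in>Ob C. F\<^sub>1 X X (Ident C X) = Ident D (F\<^sub>0 X)) \<and>
    (\<forall>X\<in>Ob C. \<forall>Y\<in>Ob C. \<forall>Z\<in>Ob C. \<forall>f\<in>Mor C X Y. \<forall>g\<in>Mor C Y Z.
      F\<^sub>1 X Z (Comp C X Y Z g f) = Comp D (F\<^sub>0 X) (F\<^sub>0 Y) (F\<^sub>0 Z) (F\<^sub>1 Y Z g) (F\<^sub>1 X Y f))"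

text \<open>
  HOL cannot quantify existentially over the types of the finite category, so its objects and
  morphisms are natural numbers. Every finite category is isomorphic to such a one, so this
  is no restriction; see \<open>residually_finiteI\<close> below.
\<close>

definition residually_finite :: "('o, 'a) category \<Rightarrow> bool" where
  "residually_finite C \<longleftrightarrow>
    (\<forall>X Y f X' Y' g.
      (X, Y, f) \<in> arrows C \<longrightarrow> (X', Y', g) \<in> arrows C \<longrightarrow> (X, Y, f) \<noteq> (X', Y', g) \<longrightarrow>
      (\<exists>(D :: (nat, nat) category) F\<^sub>0 F\<^sub>1.
        finite_category D \<and> is_functor C D F\<^sub>0 F\<^sub>1 \<and>
        (F\<^sub>0 X, F\<^sub>0 Y, F\<^sub>1 X Y f) \<noteq> (F\<^sub>0 X', F\<^sub>0 Y', F\<^sub>1 X' Y' g)))"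

lemma finite_category_nat_copy:
  fixes D :: "('p, 'b) category"
  assumes fin: "finite_category D"
  obtains E :: "(nat, nat) category" and e\<^sub>0 e\<^sub>1
  where "finite_category E" "is_functor D E e\<^sub>0 e\<^sub>1"
    and "\<And>X Y f X' Y' g. \<lbrakk>(X, Y, f) \<in> arrows D; (X', Y', g) \<in> arrows D;
          (e\<^sub>0 X, e\<^sub>0 Y, e\<^sub>1 X Y f) = (e\<^sub>0 X', e\<^sub>0 Y', e\<^sub>1 X' Y' g)\<rbrakk> \<Longrightarrow> (X, Y, f) = (X', Y', g)"
proof -
  interpret category D using fin by (simp add: finite_category_def)
  define M where "M = (\<Union>X\<in>Ob D. \<Union>Y\<in>Ob D. Mor D X Y)"
  have "finite (Ob D)" "finite M" using fin by (auto simp: finite_category_def M_def)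
  then obtain a b where a: "inj_on (a :: 'p \<Rightarrow> nat) (Ob D)" and b: "inj_on (b :: 'b \<Rightarrow> nat) M"
    by (meson finite_imp_inj_to_nat_seg)
  have M: "f \<in> M" if "X \<in> Ob D" "Y \<in> Ob D" "f \<in> Mor D X Y" for X Y f
    using that by (auto simp: M_def)
  define u where "u = inv_into (Ob D) a"
  define v where "v = inv_into M b"
  have u [simp]: "u (a X) = X" if "X \<in> Ob D" for X
    using a that by (simp add: u_def)
  have v [simp]: "v (b f) = f" if "f \<in> M" for f
    using b that by (simp add: v_def)
  define E where "E = \<lparr>Ob = a ` Ob D, Mor = (\<lambda>X Y. b ` Mor D (u X) (u Y)),
      Ident = (\<lambda>X. b (Ident D (u X))),
      Comp = (\<lambda>X Y Z g f. b (Comp D (u X) (u Y) (u Z) (v g) (v f)))\<rparr>"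
  note [simp] = Ident_in_Mor Comp_in_Mor Comp_Ident_right Comp_Ident_left
  have "category E"
  proof
    fix W X Y Z f g h
    assume "W \<in> Ob E" "X \<in> Ob E" "Y \<in> Ob E" "Z \<in> Ob E"
      "f \<in> Mor E W X" "g \<in> Mor E X Y" "h \<in> Mor E Y Z"
    then show "Comp E W Y Z h (Comp E W X Y g f) = Comp E W X Z (Comp E X Y Z h g) f"
      by (clarsimp simp: E_def) (simp add: M Comp_assoc M[OF _ _ Comp_in_Mor])
  qed (auto simp: E_def M M[OF _ _ Ident_in_Mor])
  then have "finite_category E"
    using fin by (auto simp: finite_category_def E_def)
  moreover have "is_functor D E a (\<lambda>_ _. b)"
    by (auto simp: is_functor_def E_def M)
  moreover have "(X, Y, f) = (X', Y', g)"
    if "(X, Y, f) \<in> arrows D" "(X', Y', g) \<in> arrows D" "(a X, a Y, b f) = (a X', a Y', b g)"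
    for X Y f X' Y' g
    using that M[of X Y f] M[of X' Y' g] a b by (auto simp: arrows_def dest: inj_onD)
  ultimately show thesis by (rule that)
qed

lemma is_functor_comp:
  assumes "is_functor C D F\<^sub>0 F\<^sub>1" "is_functor D E G\<^sub>0 G\<^sub>1"
  shows "is_functor C E (G\<^sub>0 \<circ> F\<^sub>0) (\<lambda>X Y. G\<^sub>1 (F\<^sub>0 X) (F\<^sub>0 Y) \<circ> F\<^sub>1 X Y)"
  using assms by (simp add: is_functor_def)

lemma residually_finiteI:
  fixes C :: "('o, 'a) category"
  assumes "\<And>X Y f X' Y' g.
      \<lbrakk>(X, Y, f) \<in> arrows C; (X', Y', g) \<in> arrows C; (X, Y, f) \<noteq> (X', Y', g)\<rbrakk> \<Longrightarrow>
      \<exists>(D :: ('p, 'b) category) F\<^sub>0 F\<^sub>1. finite_category D \<and> is_functor C D F\<^sub>0 F\<^sub>1 \<and>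
        (F\<^sub>0 X, F\<^sub>0 Y, F\<^sub>1 X Y f) \<noteq> (F\<^sub>0 X', F\<^sub>0 Y', F\<^sub>1 X' Y' g)"
  shows "residually_finite C"
  unfolding residually_finite_def
proof (intro allI impI)
  fix X Y f X' Y' g
  assume arr: "(X, Y, f) \<in> arrows C" "(X', Y', g) \<in> arrows C" and ne: "(X, Y, f) \<noteq> (X', Y', g)"
  obtain D :: "('p, 'b) category" and F\<^sub>0 F\<^sub>1
    where D: "finite_category D" and F: "is_functor C D F\<^sub>0 F\<^sub>1"
      and sep: "(F\<^sub>0 X, F\<^sub>0 Y, F\<^sub>1 X Y f) \<noteq> (F\<^sub>0 X', F\<^sub>0 Y', F\<^sub>1 X' Y' g)"
    using assms[OF arr ne] by blast
  obtain E :: "(nat, nat) category" and e\<^sub>0 e\<^sub>1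
    where E: "finite_category E" and e: "is_functor D E e\<^sub>0 e\<^sub>1"
      and inj: "\<And>X Y f X' Y' g. \<lbrakk>(X, Y, f) \<in> arrows D; (X', Y', g) \<in> arrows D;
          (e\<^sub>0 X, e\<^sub>0 Y, e\<^sub>1 X Y f) = (e\<^sub>0 X', e\<^sub>0 Y', e\<^sub>1 X' Y' g)\<rbrakk> \<Longrightarrow> (X, Y, f) = (X', Y', g)"
    using finite_category_nat_copy[OF D] by blast
  have "(F\<^sub>0 X, F\<^sub>0 Y, F\<^sub>1 X Y f) \<in> arrows D" "(F\<^sub>0 X', F\<^sub>0 Y', F\<^sub>1 X' Y' g) \<in> arrows D"
    using arr F by (auto simp: arrows_def is_functor_def)
  then have "((e\<^sub>0 \<circ> F\<^sub>0) X, (e\<^sub>0 \<circ> F\<^sub>0) Y, (e\<^sub>1 (F\<^sub>0 X) (F\<^sub>0 Y) \<circ> F\<^sub>1 X Y) f)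
      \<noteq> ((e\<^sub>0 \<circ> F\<^sub>0) X', (e\<^sub>0 \<circ> F\<^sub>0) Y', (e\<^sub>1 (F\<^sub>0 X') (F\<^sub>0 Y') \<circ> F\<^sub>1 X' Y') g)"
    using inj sep by (metis comp_apply)
  with E is_functor_comp[OF F e]
  show "\<exists>(D :: (nat, nat) category) F\<^sub>0 F\<^sub>1. finite_category D \<and> is_functor C D F\<^sub>0 F\<^sub>1 \<and>
      (F\<^sub>0 X, F\<^sub>0 Y, F\<^sub>1 X Y f) \<noteq> (F\<^sub>0 X', F\<^sub>0 Y', F\<^sub>1 X' Y' g)"
    by blast
qed

section \<open>Finite-dimensional vector spaces\<close>

text \<open>
  Objects are the finite-dimensional \<open>K\<close>-vector spaces whose underlying set lies in the type
  \<open>'v\<close>. Linear maps are extensional, i.e. \<open>undefined\<close> outside their domain, so that equality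
  in HOL is equality of maps on the domain. The fields \<open>mult\<close> and \<open>one\<close>, which \<open>module\<close>
  inherits from \<open>ring\<close>, and the values of the operations outside the carrier are
  unconstrained; records differing only there are distinct, isomorphic objects.
\<close>

definition fin_dim_vect ::
    "('k, 'r) ring_scheme \<Rightarrow> (('k, 'v) module, 'v \<Rightarrow> 'v) category" where
  "fin_dim_vect K = \<lparr>
    Ob = {V. vectorspace K V \<and> vectorspace.fin_dim K V},
    Mor = (\<lambda>V W. module_hom K V W \<inter> extensional (carrier V)),
    Ident = (\<lambda>V. \<lambda>v\<in>carrier V. v),
    Comp = (\<lambda>U V W g f. compose (carrier U) g f)\<rparr>"

lemma category_fin_dim_vect: "category (fin_dim_vect K)"
proof
  fix X Y Z f g
  assume "f \<in> Mor (fin_dim_vect K) X Y" "g \<in> Mor (fin_dim_vect K) Y Z"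
    "X \<in> Ob (fin_dim_vect K)"
  moreover from this have "Module.module K X"
    by (simp add: fin_dim_vect_def vectorspace_def)
  ultimately show "Comp (fin_dim_vect K) X Y Z g f \<in> Mor (fin_dim_vect K) X Z"
    by (auto simp: fin_dim_vect_def module_hom_def compose_def Pi_iff module.smult_closed
        abelian_monoid.a_closed abelian_group_def Module.module_def)
next
  fix X assume "X \<in> Ob (fin_dim_vect K)"
  then have "Module.module K X"
    by (simp add: fin_dim_vect_def vectorspace_def)
  then show "Ident (fin_dim_vect K) X \<in> Mor (fin_dim_vect K) X X"
    by (auto simp: fin_dim_vect_def module_hom_def module.smult_closed
        abelian_monoid.a_closed abelian_group_def Module.module_def)
qed (auto simp: fin_dim_vect_def module_hom_def compose_def extensional_def fun_eq_iff Pi_iff)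

end

theory Submission
  imports Defs "HOL-Algebra.Algebraic_Closure" "HOL-Algebra.IntRing" "HOL-Number_Theory.Residues"
begin

text \<open>
  Choose bases. Composition of linear maps becomes matrix multiplication, so all morphisms of
  \<open>C\<close> have their entries in the subring \<open>R\<close> of \<open>K\<close> generated by the finitely many entries of
  the generators (and of the identities). Two different parallel morphisms differ in an entry,
  and a ring homomorphism from \<open>R\<close> with finite image that does not kill the difference of
  these entries gives, applied entrywise, a functor to a finite category that separates them.
  Hence everything rests on the fact that finitely generated subrings of a field are
  residually finite.

  That fact is proved by adjoining the generators of the ring one at a time
  (\<open>residually_finite_adjoin\<close>), with homomorphisms into algebraically closed fields. For the
  multiples of \<open>1\<close> one reduces modulo a suitable prime \<open>p\<close> and passes to the algebraic closure
  of the field with \<open>p\<close> elements. For the step from \<open>R\<close> to \<open>R[x]\<close>, let \<open>h(x) \<noteq> 0\<close> be the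
  element to be kept nonzero. There are a polynomial \<open>p\<close> over \<open>R\<close> and a nonzero scalar \<open>b\<close> such
  that each homomorphism on \<open>R\<close> that does not kill \<open>b\<close> extends to \<open>R[x]\<close> by sending \<open>x\<close> to a
  root of the image of \<open>p\<close>, with \<open>h(x)\<close> not in the kernel
  (\<open>simple_extension_presentation\<close>, \<open>extend_to_simple_extension\<close>). Pseudo-division by \<open>p\<close>
  shows that the image remains finite (\<open>finite_eval_image\<close>). This replaces the usual
  argument by means of maximal ideals and the Nullstellensatz.
\<close>

section \<open>Relations satisfied by an adjoined element\<close>

lemma (in domain) nat_pow_nonzero:
  assumes "a \<in> carrier R" "a \<noteq> \<zero>"
  shows "a [^] (k::nat) \<noteq> \<zero>"
  using assms by (induction k) (auto simp: integral_iff)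

text \<open>
  Divisibility after clearing denominators: \<open>p\<close> divides \<open>g\<close> over the ring obtained by
  inverting the leading coefficient of \<open>p\<close>. Long division without remainder over a ring
  yields this relation, since leading coefficients have no inverses there.
\<close>

definition (in UP_ring) pseudo_dvd (infix "pdvd" 50) where
  "p pdvd g \<longleftrightarrow> (\<exists>k::nat. \<exists>q\<in>carrier P. lcoeff p [^] k \<odot>\<^bsub>P\<^esub> g = p \<otimes>\<^bsub>P\<^esub> q)"

text \<open>
  Think of \<open>ev\<close> as evaluation at an element \<open>x\<close> of a domain that contains \<open>R\<close>. The polynomial \<open>p\<close> and the
  scalar \<open>a\<close> are chosen such that a homomorphism on \<open>R\<close> that kills neither \<open>a\<close> nor the
  leading coefficient of \<open>p\<close>, followed by sending \<open>x\<close> to a root of \<open>p\<close>, is well defined on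
  \<open>R[x]\<close> (every relation satisfied by \<open>x\<close> is a pseudo-multiple of \<open>p\<close>) and does not kill
  \<open>h(x)\<close> (modulo \<open>p\<close>, the polynomial \<open>h\<close> divides the scalar \<open>a\<close>).

  If \<open>x\<close> is transcendental, its only relation is \<open>0\<close>, so \<open>p\<close> is free to be chosen, and
  \<open>p = 1 + x h\<close> makes \<open>h\<close> invertible at each root of \<open>p\<close>. If \<open>x\<close> is algebraic, \<open>p\<close> is a
  relation of minimal degree; a multiple of \<open>h(x)\<close> that is represented by a nonzero
  polynomial of minimal degree is then a scalar, since otherwise dividing \<open>p\<close> by it would
  yield a smaller multiple or a smaller relation.
\<close>

lemma (in UP_domain) simple_extension_presentation:
  assumes K: "domain K" and ev: "ev \<in> ring_hom P K"
    and inj: "\<And>a. a \<in> carrier R \<Longrightarrow> ev (up_ring.monom P a 0) = \<zero>\<^bsub>K\<^esub> \<Longrightarrow> a = \<zero>"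
    and h: "h \<in> carrier P" "ev h \<noteq> \<zero>\<^bsub>K\<^esub>"
  obtains p a u where "p \<in> carrier P" "deg R p > 0" "a \<in> carrier R" "a \<noteq> \<zero>" "u \<in> carrier P"
    "\<And>g. g \<in> carrier P \<Longrightarrow> ev g = \<zero>\<^bsub>K\<^esub> \<Longrightarrow> p pdvd g"
    "p pdvd (u \<otimes>\<^bsub>P\<^esub> h \<ominus>\<^bsub>P\<^esub> up_ring.monom P a 0)"
proof -
  interpret K: "domain" K by fact
  interpret ev: ring_hom_cring P K ev
    by (intro ring_hom_cringI UP_cring K.cring_axioms ev)
  have ev_smult: "ev (c [^] (k::nat) \<odot>\<^bsub>P\<^esub> g) = ev (up_ring.monom P c 0) [^]\<^bsub>K\<^esub> k \<otimes>\<^bsub>K\<^esub> ev g"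
    if "c \<in> carrier R" "g \<in> carrier P" for c k g
    using that monom_pow[of c 0 k] by (simp flip: monom_mult_is_smult add: ev.hom_pow[symmetric])
  have ev_lcoeff: "ev (up_ring.monom P (lcoeff g) 0) \<noteq> \<zero>\<^bsub>K\<^esub>" if "g \<in> carrier P" "g \<noteq> \<zero>\<^bsub>P\<^esub>" for g
    using inj[of "lcoeff g"] lcoeff_nonzero[of g] that by auto
  show thesis
  proof (cases "\<exists>p\<in>carrier P. p \<noteq> \<zero>\<^bsub>P\<^esub> \<and> ev p = \<zero>\<^bsub>K\<^esub>")
    case False
    \<comment> \<open>The transcendental case; \<open>Y\<close> is the indeterminate.\<close>
    define Y where "Y = up_ring.monom P \<one> 1"
    define p where "p = \<one>\<^bsub>P\<^esub> \<oplus>\<^bsub>P\<^esub> Y \<otimes>\<^bsub>P\<^esub> h"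
    have Y: "Y \<in> carrier P" and p: "p \<in> carrier P"
      using h by (auto simp: Y_def p_def)
    have h0: "h \<noteq> \<zero>\<^bsub>P\<^esub>" using h by auto
    have "up_ring.coeff P p (deg R h + 1) = lcoeff h"
      using h coeff_monom_mult[of \<one> h 1 "deg R h"] by (simp add: p_def Y_def)
    then have "deg R h + 1 \<le> deg R p"
      using lcoeff_nonzero[OF h0 h(1)] by (intro deg_belowI p) simp
    then have "deg R p > 0" by simp
    moreover have "p pdvd g" if "g \<in> carrier P" "ev g = \<zero>\<^bsub>K\<^esub>" for g
    proof -
      have "g = \<zero>\<^bsub>P\<^esub>" using False that by blast
      then show ?thesis using p by (auto simp: pseudo_dvd_def intro!: bexI[of _ "\<zero>\<^bsub>P\<^esub>"])
    qed
    moreover have "p pdvd ((\<ominus>\<^bsub>P\<^esub> Y) \<otimes>\<^bsub>P\<^esub> h \<ominus>\<^bsub>P\<^esub> up_ring.monom P \<one> 0)"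
    proof -
      have "(\<ominus>\<^bsub>P\<^esub> Y) \<otimes>\<^bsub>P\<^esub> h \<ominus>\<^bsub>P\<^esub> up_ring.monom P \<one> 0 = p \<otimes>\<^bsub>P\<^esub> (\<ominus>\<^bsub>P\<^esub> \<one>\<^bsub>P\<^esub>)"
        using Y h by (simp add: p_def) algebra
      then have "lcoeff p [^] (0::nat) \<odot>\<^bsub>P\<^esub> ((\<ominus>\<^bsub>P\<^esub> Y) \<otimes>\<^bsub>P\<^esub> h \<ominus>\<^bsub>P\<^esub> up_ring.monom P \<one> 0) = p \<otimes>\<^bsub>P\<^esub> (\<ominus>\<^bsub>P\<^esub> \<one>\<^bsub>P\<^esub>)"
        using Y h p by simp
      moreover have "\<ominus>\<^bsub>P\<^esub> \<one>\<^bsub>P\<^esub> \<in> carrier P" by simp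
      ultimately show ?thesis unfolding pseudo_dvd_def by blast
    qed
    ultimately show thesis
      using that[of p \<one> "\<ominus>\<^bsub>P\<^esub> Y"] p Y by simp
  next
    case True
    define N where "N p \<longleftrightarrow> p \<in> carrier P \<and> p \<noteq> \<zero>\<^bsub>P\<^esub> \<and> ev p = \<zero>\<^bsub>K\<^esub>" for p
    \<comment> \<open>The algebraic case: \<open>N\<close> holds for the nonzero relations satisfied by \<open>x\<close>.\<close>
    obtain p\<^sub>0 where "N p\<^sub>0" using True by (auto simp: N_def)
    from ex_has_least_nat[of N, OF this, of "deg R"]
    obtain p where p: "p \<in> carrier P" "p \<noteq> \<zero>\<^bsub>P\<^esub>" "ev p = \<zero>\<^bsub>K\<^esub>"
      and p_min: "\<And>g. g \<in> carrier P \<Longrightarrow> ev g = \<zero>\<^bsub>K\<^esub> \<Longrightarrow> g = \<zero>\<^bsub>P\<^esub> \<or> deg R p \<le> deg R g"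
      unfolding N_def by blast
    have deg_p: "deg R p > 0"
    proof (rule ccontr)
      assume "\<not> ?thesis"
      then have "p = up_ring.monom P (up_ring.coeff P p 0) 0" using deg_zero_impl_monom p by simp
      with inj[of "up_ring.coeff P p 0"] p show False by (metis coeff_closed monom_zero)
    qed
    have ker: "p pdvd g" if g: "g \<in> carrier P" "ev g = \<zero>\<^bsub>K\<^esub>" for g
    proof -
      obtain q r k where qr: "q \<in> carrier P" "r \<in> carrier P"
        "lcoeff p [^] (k::nat) \<odot>\<^bsub>P\<^esub> g = p \<otimes>\<^bsub>P\<^esub> q \<oplus>\<^bsub>P\<^esub> r" "r = \<zero>\<^bsub>P\<^esub> \<or> deg R r < deg R p"
        using long_div_theorem[OF p(1) g(1) p(2)] by blast
      have "ev (lcoeff p [^] k \<odot>\<^bsub>P\<^esub> g) = \<zero>\<^bsub>K\<^esub>"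
        using p g by (subst ev_smult) auto
      then have "ev r = \<zero>\<^bsub>K\<^esub>" using qr p by simp
      then have "r = \<zero>\<^bsub>P\<^esub>" using p_min[of r] qr by auto
      then show ?thesis using qr p by (auto simp: pseudo_dvd_def)
    qed
    \<comment> \<open>\<open>M\<close> holds for the representatives of the nonzero multiples of \<open>h(x)\<close>.\<close>
    define M where "M r \<longleftrightarrow> r \<in> carrier P \<and> ev r \<noteq> \<zero>\<^bsub>K\<^esub> \<and> (\<exists>u\<in>carrier P. ev r = ev u \<otimes>\<^bsub>K\<^esub> ev h)" for r
    have "M h" using h by (auto simp: M_def intro!: bexI[of _ "\<one>\<^bsub>P\<^esub>"])
    then obtain r where r: "M r" and r_min: "\<And>s. M s \<Longrightarrow> deg R r \<le> deg R s"
      using ex_has_least_nat[of M h "deg R"] by blast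
    from r obtain u where rP: "r \<in> carrier P" "ev r \<noteq> \<zero>\<^bsub>K\<^esub>" and u: "u \<in> carrier P" "ev r = ev u \<otimes>\<^bsub>K\<^esub> ev h"
      by (auto simp: M_def)
    have r0: "r \<noteq> \<zero>\<^bsub>P\<^esub>" using rP by auto
    \<comment> \<open>The remainder of \<open>r\<close> modulo \<open>p\<close> is again such a representative.\<close>
    have r_lt: "deg R r < deg R p"
    proof -
      obtain q s k where s: "q \<in> carrier P" "s \<in> carrier P"
        "lcoeff p [^] (k::nat) \<odot>\<^bsub>P\<^esub> r = p \<otimes>\<^bsub>P\<^esub> q \<oplus>\<^bsub>P\<^esub> s" "s = \<zero>\<^bsub>P\<^esub> \<or> deg R s < deg R p"
        using long_div_theorem[OF p(1) rP(1) p(2)] by blast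
      let ?c = "ev (up_ring.monom P (lcoeff p) 0) [^]\<^bsub>K\<^esub> k"
      have c: "?c \<noteq> \<zero>\<^bsub>K\<^esub>" "?c \<in> carrier K"
        using ev_lcoeff[OF p(1,2)] p by (auto simp: K.nat_pow_nonzero)
      have es: "ev s = ?c \<otimes>\<^bsub>K\<^esub> ev r"
        using arg_cong[OF s(3), of ev] ev_smult[of "lcoeff p" r k] s(1,2) p rP by simp
      have "ev s \<noteq> \<zero>\<^bsub>K\<^esub>" unfolding es using c rP by (simp add: K.integral_iff)
      moreover have "ev s = ev (lcoeff p [^] k \<odot>\<^bsub>P\<^esub> u) \<otimes>\<^bsub>K\<^esub> ev h"
        using p u c h by (simp add: es ev_smult K.m_assoc)
      ultimately have "M s" using s p u by (auto simp: M_def)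
      moreover have "s \<noteq> \<zero>\<^bsub>P\<^esub>" using \<open>ev s \<noteq> _\<close> by auto
      ultimately show ?thesis using r_min[of s] s by auto
    qed
    \<comment> \<open>Otherwise a scalar multiple of \<open>p\<close> would equal \<open>r q\<close>, with \<open>q\<close> a relation of smaller degree than \<open>p\<close>.\<close>
    have deg_r: "deg R r = 0"
    proof (rule ccontr)
      assume dr: "deg R r \<noteq> 0"
      obtain q s k where s: "q \<in> carrier P" "s \<in> carrier P"
        "lcoeff r [^] (k::nat) \<odot>\<^bsub>P\<^esub> p = r \<otimes>\<^bsub>P\<^esub> q \<oplus>\<^bsub>P\<^esub> s" "s = \<zero>\<^bsub>P\<^esub> \<or> deg R s < deg R r"
        using long_div_theorem[OF rP(1) p(1) r0] by blast
      have "ev (lcoeff r [^] k \<odot>\<^bsub>P\<^esub> p) = \<zero>\<^bsub>K\<^esub>"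
        using p rP by (subst ev_smult) auto
      then have sum0: "ev r \<otimes>\<^bsub>K\<^esub> ev q \<oplus>\<^bsub>K\<^esub> ev s = \<zero>\<^bsub>K\<^esub>" using s rP by simp
      then have es: "ev s = ev (\<ominus>\<^bsub>P\<^esub> (q \<otimes>\<^bsub>P\<^esub> u)) \<otimes>\<^bsub>K\<^esub> ev h"
      proof -
        have "ev s = \<ominus>\<^bsub>K\<^esub> (ev r \<otimes>\<^bsub>K\<^esub> ev q)"
          using sum0 s(1,2) rP K.minus_equality[of "ev s" "ev r \<otimes>\<^bsub>K\<^esub> ev q"] by (simp add: K.a_comm)
        then show ?thesis using s(1) u h by (simp add: K.l_minus K.r_minus K.m_ac)
      qed
      have es0: "ev s = \<zero>\<^bsub>K\<^esub>"
      proof (rule ccontr)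
        assume ne: "ev s \<noteq> \<zero>\<^bsub>K\<^esub>"
        then have "M s" using es s u unfolding M_def by blast
        then show False using r_min[of s] s ne by auto
      qed
      then have s0: "s = \<zero>\<^bsub>P\<^esub>" using p_min[of s] s r_lt by auto
      have "ev q = \<zero>\<^bsub>K\<^esub>" using sum0 es0 s rP by (simp add: K.integral_iff)
      moreover have eq: "lcoeff r [^] k \<odot>\<^bsub>P\<^esub> p = r \<otimes>\<^bsub>P\<^esub> q" using s s0 rP by simp
      moreover have lr: "lcoeff r [^] k \<noteq> \<zero>" "lcoeff r [^] k \<in> carrier R"
        using lcoeff_nonzero[OF r0 rP(1)] rP by (auto simp: R.nat_pow_nonzero)
      moreover have "q \<noteq> \<zero>\<^bsub>P\<^esub>"
      proof
        assume "q = \<zero>\<^bsub>P\<^esub>"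
        then have "up_ring.monom P (lcoeff r [^] k) 0 \<otimes>\<^bsub>P\<^esub> p = \<zero>\<^bsub>P\<^esub>" 
          using eq lr p rP by (simp add: monom_mult_is_smult)
        then have "up_ring.monom P (lcoeff r [^] k) 0 = \<zero>\<^bsub>P\<^esub>"
          using UP_integral lr p by (metis monom_closed)
        then have "up_ring.coeff P (up_ring.monom P (lcoeff r [^] k) 0) 0 = \<zero>" by simp
        then show False using lr by simp
      qed
      ultimately have "deg R p = deg R r + deg R q" "deg R p \<le> deg R q"
        using deg_smult[OF lr(2) p(1)] deg_mult[OF r0 _ rP(1) s(1)] p_min[of q] s by auto
      then show False using dr by simp
    qed
    define a where "a = up_ring.coeff P r 0"
    have r_a: "r = up_ring.monom P a 0" and a: "a \<in> carrier R"
      using deg_zero_impl_monom[OF rP(1) deg_r] rP by (auto simp: a_def)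
    have "a \<noteq> \<zero>" using r_a r0 by auto
    moreover have "p pdvd (u \<otimes>\<^bsub>P\<^esub> h \<ominus>\<^bsub>P\<^esub> up_ring.monom P a 0)"
      using u h rP by (intro ker) (auto simp flip: r_a simp: a_minus_def K.r_neg)
    ultimately show thesis using that p deg_p a u ker by blast
  qed
qed

section \<open>Homomorphisms on a simple extension\<close>

lemma (in UP_pre_univ_prop) eval_pseudo_dvd:
  assumes "domain S" and s: "s \<in> carrier S"
    and p: "p \<in> carrier P" "h (lcoeff p) \<noteq> \<zero>\<^bsub>S\<^esub>" "UnivPoly.eval R S h s p = \<zero>\<^bsub>S\<^esub>"
    and g: "g \<in> carrier P" "p pdvd g"
  shows "UnivPoly.eval R S h s g = \<zero>\<^bsub>S\<^esub>"
proof -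
  interpret S: "domain" S by fact
  interpret ev: UP_univ_prop R S h P s "UnivPoly.eval R S h s"
    using s by unfold_locales auto
  obtain k q where q: "q \<in> carrier P" "lcoeff p [^] (k::nat) \<odot>\<^bsub>P\<^esub> g = p \<otimes>\<^bsub>P\<^esub> q"
    using g by (auto simp: pseudo_dvd_def)
  have "h (lcoeff p) [^]\<^bsub>S\<^esub> k \<otimes>\<^bsub>S\<^esub> UnivPoly.eval R S h s g = UnivPoly.eval R S h s p \<otimes>\<^bsub>S\<^esub> UnivPoly.eval R S h s q"
    using arg_cong[OF q(2), of "UnivPoly.eval R S h s"] p(1) g(1) q(1)
    by (simp add: ev.Eval_smult)
  then show ?thesis
    using p g q S.nat_pow_nonzero[of "h (lcoeff p)" k] by (simp add: S.integral_iff)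
qed

text \<open>
  Division by \<open>p\<close> reduces every value of the evaluation to a combination of
  \<open>1, s, ..., s^n\<close> with coefficients in the finite image of \<open>R\<close>, up to a factor that is a
  power of the image of the leading coefficient. That power again lies in the finite image.
\<close>

lemma (in UP_pre_univ_prop) finite_eval_image:
  assumes "field S" and s: "s \<in> carrier S" and fin: "finite (h ` carrier R)"
    and p: "p \<in> carrier P" "deg R p > 0" "h (lcoeff p) \<noteq> \<zero>\<^bsub>S\<^esub>" "UnivPoly.eval R S h s p = \<zero>\<^bsub>S\<^esub>"
  shows "finite (UnivPoly.eval R S h s ` carrier P)"
proof -
  interpret S: field S by fact
  interpret ev: UP_univ_prop R S h P s "UnivPoly.eval R S h s"
    using s by unfold_locales auto
  \<comment> \<open>The degree bound for remainders modulo \<open>p\<close>, as \<open>p\<close> has positive degree.\<close>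
  define n where "n = deg R p - 1"
  let ?A = "h ` carrier R"
  let ?F = "\<lambda>(c, f). inv\<^bsub>S\<^esub> c \<otimes>\<^bsub>S\<^esub> (\<Oplus>\<^bsub>S\<^esub> i \<in> {..n}. f i \<otimes>\<^bsub>S\<^esub> s [^]\<^bsub>S\<^esub> i)"
  have "UnivPoly.eval R S h s g \<in> ?F ` (?A \<times> ({..n} \<rightarrow>\<^sub>E ?A))" if g: "g \<in> carrier P" for g
  proof -
    have p0: "p \<noteq> \<zero>\<^bsub>P\<^esub>" using p(2) by auto
    obtain q r k where qr: "q \<in> carrier P" "r \<in> carrier P"
      "lcoeff p [^] (k::nat) \<odot>\<^bsub>P\<^esub> g = p \<otimes>\<^bsub>P\<^esub> q \<oplus>\<^bsub>P\<^esub> r" "r = \<zero>\<^bsub>P\<^esub> \<or> deg R r < deg R p"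
      using long_div_theorem[OF p(1) g p0] by blast
    let ?c = "h (lcoeff p [^] k)"
    have c: "?c \<in> carrier S" "?c \<noteq> \<zero>\<^bsub>S\<^esub>"
      using p by (auto simp: S.nat_pow_nonzero)
    have cg: "?c \<otimes>\<^bsub>S\<^esub> UnivPoly.eval R S h s g = UnivPoly.eval R S h s r"
      using arg_cong[OF qr(3), of "UnivPoly.eval R S h s"] p g qr(1,2)
      by (simp add: ev.Eval_smult)
    have "deg R r \<le> n" using qr p(2) by (auto simp: n_def)
    then have "r = (\<Oplus>\<^bsub>P\<^esub> i \<in> {..n}. up_ring.monom P (up_ring.coeff P r i) i)"
      using up_repr_le qr by simp
    then have "UnivPoly.eval R S h s r = (\<Oplus>\<^bsub>S\<^esub> i \<in> {..n}. UnivPoly.eval R S h s (up_ring.monom P (up_ring.coeff P r i) i))"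
      using qr ev.hom_finsum[of "\<lambda>i. up_ring.monom P (up_ring.coeff P r i) i" "{..n}"] by (simp add: Pi_def o_def)
    also have "\<dots> = (\<Oplus>\<^bsub>S\<^esub> i \<in> {..n}. h (up_ring.coeff P r i) \<otimes>\<^bsub>S\<^esub> s [^]\<^bsub>S\<^esub> i)"
      using qr s by (intro S.finsum_cong') (auto simp: ev.Eval_monom)
    also have "\<dots> = (\<Oplus>\<^bsub>S\<^esub> i \<in> {..n}. (\<lambda>i\<in>{..n}. h (up_ring.coeff P r i)) i \<otimes>\<^bsub>S\<^esub> s [^]\<^bsub>S\<^esub> i)"
      using qr s by (intro S.finsum_cong') auto
    finally have "UnivPoly.eval R S h s r = \<dots>" .
    moreover have "UnivPoly.eval R S h s g = inv\<^bsub>S\<^esub> ?c \<otimes>\<^bsub>S\<^esub> UnivPoly.eval R S h s r"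
      using c g S.field_Units by (simp flip: cg S.m_assoc)
    ultimately have "UnivPoly.eval R S h s g = ?F (?c, \<lambda>i\<in>{..n}. h (up_ring.coeff P r i))" by simp
    moreover have "(?c, \<lambda>i\<in>{..n}. h (up_ring.coeff P r i)) \<in> ?A \<times> ({..n} \<rightarrow>\<^sub>E ?A)"
      using p(1) qr(2) by (auto simp del: hom_pow)
    ultimately show ?thesis by blast
  qed
  moreover have "finite (?F ` (?A \<times> ({..n} \<rightarrow>\<^sub>E ?A)))"
    by (rule finite_imageI) (intro finite_cartesian_product finite_PiE fin finite_atMost)
  ultimately show ?thesis by (meson finite_subset image_subsetI)
qed

text \<open>
  Algebraically closed fields are defined by means of polynomials that are coefficient lists,
  leading coefficient first; this links them to polynomials that are coefficient functions.
\<close>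

lemma (in ring) eval_descending_list:
  assumes "f \<in> UNIV \<rightarrow> carrier R" "x \<in> carrier R"
  shows "eval (map f (rev [0..<Suc n])) x = (\<Oplus>i\<in>{..n}. f i \<otimes> x [^] i)"
proof (induction n)
  case 0
  then show ?case using assms by (simp add: Pi_iff)
next
  case (Suc n)
  have "f i \<otimes> x [^] i \<in> carrier R" for i using assms by (auto simp: Pi_iff)
  then show ?case using assms Suc by (simp add: Pi_iff)
qed

lemma (in UP_pre_univ_prop) exists_root_of_image:
  assumes "algebraically_closed S"
    and p: "p \<in> carrier P" "deg R p > 0" "h (lcoeff p) \<noteq> \<zero>\<^bsub>S\<^esub>"
  obtains s where "s \<in> carrier S" "UnivPoly.eval R S h s p = \<zero>\<^bsub>S\<^esub>"
proof -
  interpret S: algebraically_closed S by fact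
  define f where "f i = h (up_ring.coeff P p i)" for i
  define l where "l = map f (rev [0..<Suc (deg R p)])"
  have l: "l \<in> carrier (poly_ring S)"
    using p by (auto simp: l_def f_def polynomial_def simp flip: univ_poly_carrier)
  have "length l - 1 = deg R p" by (simp add: l_def)
  then have "S.roots l \<noteq> {#}"
    using S.roots_over_carrier[OF l] p(2) by (auto simp: S.splitted_def)
  then obtain s where "S.is_root l s"
    using S.roots_mem_iff_is_root[OF l] by blast
  then have s: "s \<in> carrier S" "S.eval l s = \<zero>\<^bsub>S\<^esub>" by (auto simp: S.is_root_def)
  moreover have "f \<in> UNIV \<rightarrow> carrier S" using p by (auto simp: f_def)
  ultimately have "UnivPoly.eval R S h s p = \<zero>\<^bsub>S\<^esub>"
    using S.eval_descending_list[of f s "deg R p"] p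
    by (simp add: l_def eval_on_carrier f_def)
  then show thesis using that s by blast
qed

lemma ring_hom_factor:
  assumes P: "ring P" and K: "ring K" and L: "ring L"
    and f: "f \<in> ring_hom P K" and g: "g \<in> ring_hom P L"
    and ker: "\<And>x. x \<in> carrier P \<Longrightarrow> f x = \<zero>\<^bsub>K\<^esub> \<Longrightarrow> g x = \<zero>\<^bsub>L\<^esub>"
  obtains \<psi> where "\<psi> \<in> ring_hom (K\<lparr>carrier := f ` carrier P\<rparr>) L" "\<forall>x\<in>carrier P. \<psi> (f x) = g x"
proof -
  interpret f: ring_hom_ring P K f by (intro ring_hom_ringI2 P K f)
  interpret g: ring_hom_ring P L g by (intro ring_hom_ringI2 P L g)
  have eq: "g x = g y" if "x \<in> carrier P" "y \<in> carrier P" "f x = f y" for x y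
    using ker[of "x \<ominus>\<^bsub>P\<^esub> y"] that
    by (simp add: f.R.minus_eq g.S.r_neg f.S.r_neg)
       (metis f.R.add.inv_closed f.S.r_neg f.hom_a_inv f.hom_closed g.S.add.inv_solve_right' g.S.l_zero g.hom_a_inv g.hom_closed g.S.zero_closed)
  define \<psi> where "\<psi> y = g (inv_into (carrier P) f y)" for y
  have \<psi>: "\<psi> (f x) = g x" if "x \<in> carrier P" for x
    unfolding \<psi>_def using that by (intro eq) (auto intro: inv_into_into f_inv_into_f)
  have "\<psi> \<in> ring_hom (K\<lparr>carrier := f ` carrier P\<rparr>) L"
  proof (rule ring_hom_memI; clarsimp simp: \<psi>)
    show "\<psi> \<one>\<^bsub>K\<^esub> = \<one>\<^bsub>L\<^esub>" using \<psi>[of "\<one>\<^bsub>P\<^esub>"] by simp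
    fix x y assume "x \<in> carrier P" "y \<in> carrier P"
    then show "\<psi> (f x \<otimes>\<^bsub>K\<^esub> f y) = g x \<otimes>\<^bsub>L\<^esub> g y" "\<psi> (f x \<oplus>\<^bsub>K\<^esub> f y) = g x \<oplus>\<^bsub>L\<^esub> g y"
      using \<psi>[of "x \<otimes>\<^bsub>P\<^esub> y"] \<psi>[of "x \<oplus>\<^bsub>P\<^esub> y"] by simp_all
  qed
  then show thesis using \<psi> that by (intro that[of \<psi>]) auto
qed

text \<open>
  Extension of homomorphisms to \<open>R[x]\<close>: for each \<open>h(x) \<noteq> 0\<close> there is one scalar \<open>b \<noteq> 0\<close>
  that controls all algebraically closed targets \<open>L\<close>. It is the product of the two scalars
  that must survive for the polynomial \<open>p\<close> above to have a root in \<open>L\<close> with the right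
  properties. The last clause says that evaluation at \<open>s\<close> factors through \<open>R[x]\<close>.
\<close>

lemma (in UP_domain) extend_to_simple_extension:
  fixes K :: "('k, 'r) ring_scheme"
  assumes "domain K" and i: "i \<in> ring_hom R K" "inj_on i (carrier R)" and x: "x \<in> carrier K"
    and h: "h \<in> carrier P" "UnivPoly.eval R K i x h \<noteq> \<zero>\<^bsub>K\<^esub>"
  obtains b where "b \<in> carrier R" "b \<noteq> \<zero>"
    "\<forall>(L :: 'l ring) \<phi>. algebraically_closed L \<and> \<phi> \<in> ring_hom R L \<and>
        finite (\<phi> ` carrier R) \<and> \<phi> b \<noteq> \<zero>\<^bsub>L\<^esub> \<longrightarrow>
      (\<exists>s\<in>carrier L. finite (UnivPoly.eval R L \<phi> s ` carrier P) \<and> UnivPoly.eval R L \<phi> s h \<noteq> \<zero>\<^bsub>L\<^esub> \<and>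
        (\<forall>g\<in>carrier P. UnivPoly.eval R K i x g = \<zero>\<^bsub>K\<^esub> \<longrightarrow> UnivPoly.eval R L \<phi> s g = \<zero>\<^bsub>L\<^esub>))"
proof -
  interpret K: "domain" K by fact
  interpret e: UP_pre_univ_prop R K i P
    by (rule UP_pre_univ_propI[OF R.cring_axioms K.cring_axioms i(1)], rule P_def)
  define ev where "ev = UnivPoly.eval R K i x"
  have ev: "ev \<in> ring_hom P K" unfolding ev_def by (rule e.eval_ring_hom[OF x])
  have inj: "\<And>a. \<lbrakk>a \<in> carrier R; ev (up_ring.monom P a 0) = \<zero>\<^bsub>K\<^esub>\<rbrakk> \<Longrightarrow> a = \<zero>"
    using e.eval_const[OF x] inj_onD[OF i(2), of _ \<zero>] by (simp add: ev_def)
  obtain p a u where p: "p \<in> carrier P" "deg R p > 0"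
    and a: "a \<in> carrier R" "a \<noteq> \<zero>"
    and u: "u \<in> carrier P"
    and ker: "\<And>g. g \<in> carrier P \<Longrightarrow> ev g = \<zero>\<^bsub>K\<^esub> \<Longrightarrow> p pdvd g"
    and inv: "p pdvd (u \<otimes>\<^bsub>P\<^esub> h \<ominus>\<^bsub>P\<^esub> up_ring.monom P a 0)"
    using simple_extension_presentation[OF K.domain_axioms ev inj] h[folded ev_def] by blast
  have c: "lcoeff p \<in> carrier R" "lcoeff p \<noteq> \<zero>"
    using lcoeff_closed[OF p(1)] lcoeff_nonzero_deg[of p] p by auto
  show thesis
  proof (rule that; (intro allI impI; elim conjE)?)
    show "a \<otimes> lcoeff p \<in> carrier R" "a \<otimes> lcoeff p \<noteq> \<zero>"
      using a c R.integral_iff by auto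
    fix L :: "'l ring" and \<phi>
    assume L: "algebraically_closed L" and \<phi>: "\<phi> \<in> ring_hom R L" and fin: "finite (\<phi> ` carrier R)"
      and nz: "\<phi> (a \<otimes> lcoeff p) \<noteq> \<zero>\<^bsub>L\<^esub>"
    interpret L: algebraically_closed L by fact
    interpret f: UP_pre_univ_prop R L \<phi> P
      by (rule UP_pre_univ_propI[OF R.cring_axioms L.cring_axioms \<phi>], rule P_def)
    have \<phi>_nz: "\<phi> a \<noteq> \<zero>\<^bsub>L\<^esub>" "\<phi> (lcoeff p) \<noteq> \<zero>\<^bsub>L\<^esub>"
      using nz f.hom_mult[OF a(1) c(1)] f.hom_closed[OF a(1)] f.hom_closed[OF c(1)] by auto
    obtain s where s: "s \<in> carrier L" "UnivPoly.eval R L \<phi> s p = \<zero>\<^bsub>L\<^esub>"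
      using f.exists_root_of_image[OF L p \<phi>_nz(2)] by blast
    define ev' where "ev' = UnivPoly.eval R L \<phi> s"
    interpret ev': ring_hom_ring P L ev'
      unfolding ev'_def by (intro ring_hom_ringI2 P.ring_axioms L.ring_axioms f.eval_ring_hom s(1))
    have vanish: "ev' g = \<zero>\<^bsub>L\<^esub>" if "g \<in> carrier P" "p pdvd g" for g
      using f.eval_pseudo_dvd[OF L.domain_axioms s(1) p(1) \<phi>_nz(2) s(2) that] by (simp add: ev'_def)
    have "finite (ev' ` carrier P)"
      using f.finite_eval_image[OF L.field_axioms s(1) fin p \<phi>_nz(2) s(2)] by (simp add: ev'_def)
    moreover have "ev' h \<noteq> \<zero>\<^bsub>L\<^esub>"
    proof
      assume h0: "ev' h = \<zero>\<^bsub>L\<^esub>"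
      have a': "up_ring.monom P a 0 \<in> carrier P" using a by simp
      have "ev' (u \<otimes>\<^bsub>P\<^esub> h \<ominus>\<^bsub>P\<^esub> up_ring.monom P a 0) = \<zero>\<^bsub>L\<^esub>"
        using inv u h a' by (intro vanish) auto
      then have "ev' (up_ring.monom P a 0) = \<zero>\<^bsub>L\<^esub>"
        using u h a' h0 by (simp add: P.minus_eq)
      then show False
        using f.eval_const[OF s(1) a(1)] \<phi>_nz(1) by (simp add: ev'_def)
    qed
    ultimately show "\<exists>s\<in>carrier L. finite (UnivPoly.eval R L \<phi> s ` carrier P) \<and> UnivPoly.eval R L \<phi> s h \<noteq> \<zero>\<^bsub>L\<^esub> \<and>
        (\<forall>g\<in>carrier P. UnivPoly.eval R K i x g = \<zero>\<^bsub>K\<^esub> \<longrightarrow> UnivPoly.eval R L \<phi> s g = \<zero>\<^bsub>L\<^esub>)"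
      using s(1) ker vanish unfolding ev_def ev'_def by blast
  qed
qed

section \<open>Residual finiteness of finitely generated subrings of a field\<close>

text \<open>
  Each nonzero element of the subring survives under a homomorphism with finite image. The
  targets are algebraically closed so that homomorphisms can be extended by choosing roots.
  Their type is fixed since a definition cannot quantify over types; it is the one that the
  algebraic closure of the integers modulo a prime has.
\<close>

definition residually_finite_subring :: "('k, 'r) ring_scheme \<Rightarrow> 'k set \<Rightarrow> bool" where
  "residually_finite_subring K R \<longleftrightarrow> subring R K \<and>
    (\<forall>b\<in>R. b \<noteq> \<zero>\<^bsub>K\<^esub> \<longrightarrow>
      (\<exists>(L :: ((int list \<times> nat) multiset \<Rightarrow> int) ring) \<phi>. algebraically_closed L \<and>
        \<phi> \<in> ring_hom (K\<lparr>carrier := R\<rparr>) L \<and> finite (\<phi> ` R) \<and> \<phi> b \<noteq> \<zero>\<^bsub>L\<^esub>))"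

lemma (in ring) int_multiples_hom: "(\<lambda>k::int. [k] \<cdot> \<one>) \<in> ring_hom \<Z> R"
  by (intro ring_hom_memI)
     (auto simp: add_pow_ldistr_int add.int_pow_mult add.int_pow_pow mult.commute)

lemma algebraically_closed_char_p:
  assumes "prime p"
  obtains L :: "((int list \<times> nat) multiset \<Rightarrow> int) ring" and g
  where "algebraically_closed L" "g \<in> ring_hom \<Z> L" "finite (range g)"
    "\<forall>n. g n = \<zero>\<^bsub>L\<^esub> \<longleftrightarrow> int p dvd n"
proof -
  let ?F = "residue_ring (int p)"
  interpret F: residues_prime p ?F
    using assms by unfold_locales auto
  interpret F: field ?F by (rule F.is_field)
  obtain L :: "((int list \<times> nat) multiset \<Rightarrow> int) ring"
    where L: "algebraic_closure L (ring.indexed_const ?F ` carrier ?F)" and h: "ring.indexed_const ?F \<in> ring_hom ?F L"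
    using F.exists_closure by blast
  let ?h = "ring.indexed_const ?F :: int \<Rightarrow> (int list \<times> nat) multiset \<Rightarrow> int"
  interpret L: algebraic_closure L "?h ` carrier ?F" by fact
  interpret h: ring_hom_ring ?F L ?h
    by (intro ring_hom_ringI2 F.ring_axioms L.ring_axioms h)
  have inj: "inj_on ?h (carrier ?F)"
    using non_trivial_field_hom_is_inj[OF h F.field_axioms L.field_axioms] .
  define g where "g n = ?h (n mod int p)" for n
  have "g \<in> ring_hom \<Z> L"
  proof (rule ring_hom_memI)
    fix m n :: int
    show "g (m \<otimes>\<^bsub>\<Z>\<^esub> n) = g m \<otimes>\<^bsub>L\<^esub> g n" "g (m \<oplus>\<^bsub>\<Z>\<^esub> n) = g m \<oplus>\<^bsub>L\<^esub> g n"
      by (simp_all add: g_def flip: h.hom_mult h.hom_add F.add_cong F.mult_cong)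
    show "g m \<in> carrier L" by (simp add: g_def)
    show "g \<one>\<^bsub>\<Z>\<^esub> = \<one>\<^bsub>L\<^esub>" by (simp add: g_def flip: F.one_cong)
  qed
  moreover have "finite (range g)"
    by (rule finite_subset[of _ "?h ` carrier ?F"]) (auto simp: g_def)
  moreover have "g n = \<zero>\<^bsub>L\<^esub> \<longleftrightarrow> int p dvd n" for n
    using inj_on_eq_iff[OF inj, of "n mod int p" "\<zero>\<^bsub>?F\<^esub>"] F.zero_closed h.hom_zero
    unfolding g_def F.zero_cong by (simp add: dvd_eq_mod_eq_0)
  ultimately show thesis using that[OF L.algebraically_closed_axioms] by blast
qed

text \<open>
  In positive characteristic the prime must be the characteristic; in characteristic zero
  every prime larger than \<open>\<bar>N\<bar>\<close> will do. The last conclusion says that the reduction modulo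
  \<open>p\<close> is well defined on the multiples of \<open>1\<close>.
\<close>

lemma (in domain) exists_compatible_prime:
  fixes N :: int
  assumes "[N] \<cdot> \<one> \<noteq> \<zero>"
  obtains p where "prime p" "\<not> int p dvd N" "\<forall>n::int. [n] \<cdot> \<one> = \<zero> \<longrightarrow> int p dvd n"
proof -
  interpret f: ring_hom_ring \<Z> R "\<lambda>k::int. [k] \<cdot> \<one>"
    by (rule ring_hom_ringI2[OF int.ring_axioms ring_axioms int_multiples_hom])
  define f where "f k = [k] \<cdot> \<one>" for k :: int
  have f0: "f 0 = \<zero>" and f1: "f 1 = \<one>" and f_cl: "f k \<in> carrier R" for k
    using f.hom_zero f.hom_one f.hom_closed[of k] by (simp_all add: f_def)
  have mult: "f (m * n) = f m \<otimes> f n" for m n :: int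
    using f.hom_mult[of m n] by (simp add: f_def)
  have diff: "f (m - n) = f m \<ominus> f n" for m n :: int
    using f.hom_add[of m "-n"] f.hom_a_inv[of n] by (simp add: a_minus_def f_def)
  show thesis
  proof (cases "\<exists>n>0::nat. f (int n) = \<zero>")
    case False
    have "n = 0" if "f n = \<zero>" for n :: int
    proof (rule ccontr)
      assume "n \<noteq> 0"
      have "f (int (nat \<bar>n\<bar>)) = \<zero>"
        using that diff[of 0 n] by (cases "n \<ge> 0") (auto simp: f0 a_minus_def)
      moreover have "nat \<bar>n\<bar> > 0" using \<open>n \<noteq> 0\<close> by simp
      ultimately show False using False by blast
    qed
    moreover obtain p where p: "prime p" "p > nat \<bar>N\<bar>"
      using bigger_prime by blast
    moreover have "\<not> int p dvd N"
      using assms p zdvd_imp_le[of "int p" "\<bar>N\<bar>"] f0 by (cases "N = 0") (auto simp: f_def)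
    ultimately show thesis using that[of p] unfolding f_def by blast
  next
    case True
    \<comment> \<open>The characteristic.\<close>
    define p where "p = (LEAST n. n > 0 \<and> f (int n) = \<zero>)"
    have p: "p > 0" "f (int p) = \<zero>"
      using LeastI_ex[OF True] by (auto simp: p_def)
    have p_min: "p \<le> n" if "n > 0" "f (int n) = \<zero>" for n
      using that by (auto simp: p_def intro: Least_le)
    have dvd: "int p dvd n" if n: "f n = \<zero>" for n :: int
    proof -
      define r where "r = n mod int p"
      have "r = n - int p * (n div int p)" by (simp add: r_def minus_mult_div_eq_mod)
      then have "f r = \<zero>" using n p f_cl by (simp add: diff mult a_minus_def)
      moreover have "r \<ge> 0" "r < int p" using p by (auto simp: r_def)
      ultimately have "r = 0" using p_min[of "nat r"] by (cases "r = 0") auto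
      then show ?thesis by (auto simp: r_def)
    qed
    have "prime p"
      unfolding prime_nat_iff
    proof (intro conjI allI impI)
      show "1 < p" using p by (cases "p = 1") (auto simp: f1)
      fix m assume "m dvd p"
      then obtain k where k: "p = m * k" by (auto elim: dvdE)
      then have pos: "m > 0" "k > 0" using p(1) by auto
      have "f (int m) = \<zero> \<or> f (int k) = \<zero>"
        using p(2) by (simp add: k mult integral_iff f_cl)
      then have "p \<le> m \<or> p \<le> k" using p_min pos by blast
      then show "m = 1 \<or> m = p" using pos by (auto simp: k)
    qed
    moreover have "\<not> int p dvd N"
      using assms p f_cl by (auto simp: mult simp flip: f_def elim!: dvdE)
    ultimately show thesis using dvd that[of p] unfolding f_def by blast
  qed
qed

lemma (in field) residually_finite_prime_ring:
  "residually_finite_subring R (range (\<lambda>k::int. [k] \<cdot> \<one>))"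
  unfolding residually_finite_subring_def
proof (intro conjI ballI impI)
  interpret f: ring_hom_ring \<Z> R "\<lambda>k::int. [k] \<cdot> \<one>"
    by (rule ring_hom_ringI2[OF int.ring_axioms ring_axioms int_multiples_hom])
  show "subring (range (\<lambda>k::int. [k] \<cdot> \<one>)) R"
    using f.img_is_subring[OF ring.carrier_is_subring[OF int.ring_axioms]] by (simp only: int_carrier_eq)
  fix b assume b: "b \<in> range (\<lambda>k::int. [k] \<cdot> \<one>)" "b \<noteq> \<zero>"
  from b(1) obtain N :: int where N_b: "b = [N] \<cdot> \<one>" by (rule rangeE)
  with b(2) have N: "b = [N] \<cdot> \<one>" "[N] \<cdot> \<one> \<noteq> \<zero>" by simp_all
  obtain p where p: "prime p" "\<not> int p dvd N"
    and dvd: "\<forall>n::int. [n] \<cdot> \<one> = \<zero> \<longrightarrow> int p dvd n"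
    using exists_compatible_prime[OF N(2)] by blast
  obtain L :: "((int list \<times> nat) multiset \<Rightarrow> int) ring" and g
    where L: "algebraically_closed L" and g: "g \<in> ring_hom \<Z> L" "finite (range g)"
      "\<forall>n. g n = \<zero>\<^bsub>L\<^esub> \<longleftrightarrow> int p dvd n"
    using algebraically_closed_char_p[OF p(1)] by blast
  interpret L: algebraically_closed L by fact
  have ker: "g n = \<zero>\<^bsub>L\<^esub>" if "n \<in> carrier \<Z>" "[n] \<cdot> \<one> = \<zero>" for n
    using g(3) dvd that(2) by blast
  obtain \<psi> where \<psi>: "\<psi> \<in> ring_hom (R\<lparr>carrier := (\<lambda>k::int. [k] \<cdot> \<one>) ` carrier \<Z>\<rparr>) L"
    and \<psi>_eq: "\<forall>n\<in>carrier \<Z>. \<psi> ([n] \<cdot> \<one>) = g n"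
    using ring_hom_factor[OF int.ring_axioms ring_axioms L.ring_axioms int_multiples_hom g(1), OF ker]
    by blast
  have \<psi>_int: "\<psi> ([n] \<cdot> \<one>) = g n" for n
    using \<psi>_eq by (simp only: int_carrier_eq ball_UNIV)
  have "\<psi> ` range (\<lambda>k::int. [k] \<cdot> \<one>) = range g"
    by (simp only: image_image \<psi>_int)
  moreover have "\<psi> b \<noteq> \<zero>\<^bsub>L\<^esub>"
    using g(3) p(2) by (simp add: N(1) \<psi>_int)
  ultimately show "\<exists>(L :: ((int list \<times> nat) multiset \<Rightarrow> int) ring) \<phi>. algebraically_closed L \<and>
      \<phi> \<in> ring_hom (R\<lparr>carrier := range (\<lambda>k::int. [k] \<cdot> \<one>)\<rparr>) L \<and>
      finite (\<phi> ` range (\<lambda>k::int. [k] \<cdot> \<one>)) \<and> \<phi> b \<noteq> \<zero>\<^bsub>L\<^esub>"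
    using L \<psi>[unfolded int_carrier_eq] g(2) by (intro exI[of _ L] exI[of _ \<psi>]) simp
qed

text \<open>
  The inductive step. A homomorphism on \<open>A\<close> for which the scalar of
  \<open>extend_to_simple_extension\<close> survives exists by assumption, and it extends to \<open>A[x]\<close>.
\<close>

lemma (in field) residually_finite_adjoin:
  assumes A: "residually_finite_subring R A" and x: "x \<in> carrier R"
  obtains B where "residually_finite_subring R B" "A \<subseteq> B" "x \<in> B"
proof -
  have sub: "subring A R" using A by (simp add: residually_finite_subring_def)
  define A' where "A' = R\<lparr>carrier := A\<rparr>"
  have A'_simps: "carrier A' = A" "zero A' = \<zero>" "one A' = \<one>" by (simp_all add: A'_def)
  define P where "P = UP A'"
  interpret A: "domain" A' unfolding A'_def by (rule subring_is_domain[OF sub])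
  interpret P: UP_domain A' P by unfold_locales (rule P_def[THEN eq_reflection])
  have incl: "id \<in> ring_hom A' R"
    using subringE(1)[OF sub] by (intro ring_hom_memI) (auto simp: A'_def)
  interpret e: UP_pre_univ_prop A' R id P
    by (rule UP_pre_univ_propI[OF A.cring_axioms cring_axioms incl], rule P_def[THEN eq_reflection])
  define ev where "ev = UnivPoly.eval A' R id x"
  interpret ev: ring_hom_ring P R ev
    unfolding ev_def by (rule ring_hom_ringI2[OF P.P.ring_axioms ring_axioms e.eval_ring_hom[OF x]])
  define B where "B = ev ` carrier P"
  show thesis
  proof
    show "A \<subseteq> B"
    proof
      fix a assume "a \<in> A"
      then have "a \<in> carrier A'" by (simp only: A'_simps)
      from e.eval_const[OF x this] P.monom_closed[OF this, of 0] show "a \<in> B"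
        unfolding B_def ev_def by (intro image_eqI[of _ _ "up_ring.monom P a 0"]) simp_all
    qed
    show "x \<in> B"
      unfolding B_def ev_def
      by (rule image_eqI[where x = "up_ring.monom P \<one>\<^bsub>A'\<^esub> 1"],
          rule e.eval_monom1[OF x, symmetric], rule P.monom_closed[OF A.one_closed])
    show "residually_finite_subring R B"
      unfolding residually_finite_subring_def
    proof (intro conjI ballI impI)
      show "subring B R" unfolding B_def by (rule ev.img_is_subring[OF ring.carrier_is_subring[OF P.P.ring_axioms]])
      fix y assume "y \<in> B" "y \<noteq> \<zero>"
      then obtain h where h: "h \<in> carrier P" "y = ev h" "ev h \<noteq> \<zero>"
        unfolding B_def by (elim imageE) simp
      obtain b where b: "b \<in> carrier A'" "b \<noteq> \<zero>\<^bsub>A'\<^esub>"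
        and ext: "\<forall>(L :: ((int list \<times> nat) multiset \<Rightarrow> int) ring) \<phi>. algebraically_closed L \<and>
            \<phi> \<in> ring_hom A' L \<and> finite (\<phi> ` carrier A') \<and> \<phi> b \<noteq> \<zero>\<^bsub>L\<^esub> \<longrightarrow>
          (\<exists>s\<in>carrier L. finite (UnivPoly.eval A' L \<phi> s ` carrier P) \<and> UnivPoly.eval A' L \<phi> s h \<noteq> \<zero>\<^bsub>L\<^esub> \<and>
            (\<forall>g\<in>carrier P. ev g = \<zero> \<longrightarrow> UnivPoly.eval A' L \<phi> s g = \<zero>\<^bsub>L\<^esub>))"
        by (rule P.extend_to_simple_extension[OF domain_axioms incl inj_on_id x h(1) h(3)[unfolded ev_def], folded ev_def])
      obtain L :: "((int list \<times> nat) multiset \<Rightarrow> int) ring" and \<phi>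
        where L: "algebraically_closed L" and \<phi>: "\<phi> \<in> ring_hom A' L" "finite (\<phi> ` A)" "\<phi> b \<noteq> \<zero>\<^bsub>L\<^esub>"
        using A b unfolding residually_finite_subring_def A'_simps A'_def[symmetric] by blast
      interpret L: algebraically_closed L by fact
      interpret f: UP_pre_univ_prop A' L \<phi> P
        by (rule UP_pre_univ_propI[OF A.cring_axioms L.cring_axioms \<phi>(1)], rule P_def[THEN eq_reflection])
      obtain s where s: "s \<in> carrier L"
        and ev': "finite (UnivPoly.eval A' L \<phi> s ` carrier P)" "UnivPoly.eval A' L \<phi> s h \<noteq> \<zero>\<^bsub>L\<^esub>"
          "\<And>g. \<lbrakk>g \<in> carrier P; ev g = \<zero>\<rbrakk> \<Longrightarrow> UnivPoly.eval A' L \<phi> s g = \<zero>\<^bsub>L\<^esub>"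
        using ext[rule_format, of L \<phi>] L \<phi> unfolding A'_simps by blast
      obtain \<psi> where \<psi>: "\<psi> \<in> ring_hom (R\<lparr>carrier := B\<rparr>) L"
        "\<forall>g\<in>carrier P. \<psi> (ev g) = UnivPoly.eval A' L \<phi> s g"
        using ring_hom_factor[OF P.P.ring_axioms ring_axioms L.ring_axioms ev.homh f.eval_ring_hom[OF s], OF ev'(3)]
        unfolding B_def by metis
      have "\<psi> ` B = UnivPoly.eval A' L \<phi> s ` carrier P"
        unfolding B_def image_image by (rule image_cong[OF refl bspec[OF \<psi>(2)]])
      with ev'(1) have "finite (\<psi> ` B)" by simp
      moreover have "\<psi> y \<noteq> \<zero>\<^bsub>L\<^esub>"
        using ev'(2) bspec[OF \<psi>(2) h(1)] by (simp add: h(2))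
      ultimately show "\<exists>(L :: ((int list \<times> nat) multiset \<Rightarrow> int) ring) \<phi>. algebraically_closed L \<and>
          \<phi> \<in> ring_hom (R\<lparr>carrier := B\<rparr>) L \<and> finite (\<phi> ` B) \<and> \<phi> y \<noteq> \<zero>\<^bsub>L\<^esub>"
        using L \<psi>(1) by (intro exI[of _ L] exI[of _ \<psi>] conjI)
    qed
  qed
qed

lemma (in field) exists_residually_finite_subring:
  assumes "finite S" "S \<subseteq> carrier R"
  shows "\<exists>A. residually_finite_subring R A \<and> S \<subseteq> A"
  using assms
proof (induction S)
  case empty
  show ?case by (intro exI conjI) (rule residually_finite_prime_ring, rule empty_subsetI)
next
  case (insert x S)
  then obtain A where A: "residually_finite_subring R A" "S \<subseteq> A" by auto
  obtain B where "residually_finite_subring R B" "A \<subseteq> B" "x \<in> B"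
    by (rule residually_finite_adjoin[OF A(1)]) (use insert.prems in auto)
  with A show ?case by (intro exI[of _ B]) auto
qed

section \<open>Quotients of a category by a congruence\<close>

text \<open>
  A family of maps on the Hom-sets whose fibres are compatible with composition is the
  quotient functor of a congruence. The quotient category lives on the images of these maps,
  and its composition is defined through representatives.
\<close>

lemma (in category) image_category:
  assumes fin: "finite (Ob C)" and fin_im: "\<And>U V. U \<in> Ob C \<Longrightarrow> V \<in> Ob C \<Longrightarrow> finite (\<kappa> U V ` Mor C U V)"
    and cong: "\<And>U V W f f' g g'. \<lbrakk>U \<in> Ob C; V \<in> Ob C; W \<in> Ob C; f \<in> Mor C U V; f' \<in> Mor C U V;
        g \<in> Mor C V W; g' \<in> Mor C V W; \<kappa> U V f = \<kappa> U V f'; \<kappa> V W g = \<kappa> V W g'\<rbrakk>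
        \<Longrightarrow> \<kappa> U W (Comp C U V W g f) = \<kappa> U W (Comp C U V W g' f')"
  obtains D where "finite_category D" "is_functor C D id \<kappa>"
proof -
  define \<rho> where "\<rho> U V = inv_into (Mor C U V) (\<kappa> U V)" for U V
  have \<rho>: "\<rho> U V (\<kappa> U V f) \<in> Mor C U V" "\<kappa> U V (\<rho> U V (\<kappa> U V f)) = \<kappa> U V f"
    if "f \<in> Mor C U V" for U V f
    using that by (auto simp: \<rho>_def inv_into_into f_inv_into_f)
  define D where "D = \<lparr>Ob = Ob C, Mor = (\<lambda>U V. \<kappa> U V ` Mor C U V), Ident = (\<lambda>U. \<kappa> U U (Ident C U)),
    Comp = (\<lambda>U V W g f. \<kappa> U W (Comp C U V W (\<rho> V W g) (\<rho> U V f)))\<rparr>"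
  have Comp_D: "Comp D U V W (\<kappa> V W g) (\<kappa> U V f) = \<kappa> U W (Comp C U V W g f)"
    if "U \<in> Ob C" "V \<in> Ob C" "W \<in> Ob C" "f \<in> Mor C U V" "g \<in> Mor C V W" for U V W f g
    using that \<rho>[of f U V] \<rho>[of g V W] by (simp add: D_def) (rule cong; simp)
  have simps: "Ob D = Ob C" "Mor D U V = \<kappa> U V ` Mor C U V" "Ident D U = \<kappa> U U (Ident C U)" for U V
    by (simp_all add: D_def)
  have "category D"
    by unfold_locales
      (auto simp: simps Comp_D Ident_in_Mor Comp_in_Mor Comp_Ident_left Comp_Ident_right Comp_assoc)
  then have "finite_category D"
    using fin fin_im by (simp add: finite_category_def simps)
  moreover have "is_functor C D id \<kappa>"
    by (simp add: is_functor_def simps Comp_D)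
  ultimately show thesis by (rule that)
qed

text \<open>
  Only parallel morphisms need a separating congruence: morphisms with different source or
  target are separated by the congruence that identifies all parallel morphisms, because the
  quotient functor is the identity on objects.
\<close>

lemma (in category) residually_finite_if_congruences_separate:
  assumes fin: "finite (Ob C)"
    and sep: "\<And>U V f g. \<lbrakk>U \<in> Ob C; V \<in> Ob C; f \<in> Mor C U V; g \<in> Mor C U V; f \<noteq> g\<rbrakk> \<Longrightarrow>
      \<exists>\<kappa> :: 'o \<Rightarrow> 'o \<Rightarrow> 'a \<Rightarrow> 'c.
        (\<forall>U\<in>Ob C. \<forall>V\<in>Ob C. finite (\<kappa> U V ` Mor C U V)) \<and>
        (\<forall>U\<in>Ob C. \<forall>V\<in>Ob C. \<forall>W\<in>Ob C. \<forall>f\<in>Mor C U V. \<forall>f'\<in>Mor C U V. \<forall>g\<in>Mor C V W. \<forall>g'\<in>Mor C V W.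
          \<kappa> U V f = \<kappa> U V f' \<longrightarrow> \<kappa> V W g = \<kappa> V W g' \<longrightarrow>
          \<kappa> U W (Comp C U V W g f) = \<kappa> U W (Comp C U V W g' f')) \<and>
        \<kappa> U V f \<noteq> \<kappa> U V g"
  shows "residually_finite C"
proof (rule residually_finiteI)
  fix U V f U' V' g
  assume arr: "(U, V, f) \<in> arrows C" "(U', V', g) \<in> arrows C" and ne: "(U, V, f) \<noteq> (U', V', g)"
  show "\<exists>(D :: ('o, 'c) category) F\<^sub>0 F\<^sub>1. finite_category D \<and> is_functor C D F\<^sub>0 F\<^sub>1 \<and>
      (F\<^sub>0 U, F\<^sub>0 V, F\<^sub>1 U V f) \<noteq> (F\<^sub>0 U', F\<^sub>0 V', F\<^sub>1 U' V' g)"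
  proof (cases "U = U' \<and> V = V'")
    case True
    with arr ne have f: "U \<in> Ob C" "V \<in> Ob C" "f \<in> Mor C U V" "g \<in> Mor C U V" "f \<noteq> g"
      by (auto simp: arrows_def)
    obtain \<kappa> :: "'o \<Rightarrow> 'o \<Rightarrow> 'a \<Rightarrow> 'c"
      where fin_im: "\<forall>U\<in>Ob C. \<forall>V\<in>Ob C. finite (\<kappa> U V ` Mor C U V)"
        and cong: "\<forall>U\<in>Ob C. \<forall>V\<in>Ob C. \<forall>W\<in>Ob C. \<forall>f\<in>Mor C U V. \<forall>f'\<in>Mor C U V. \<forall>g\<in>Mor C V W. \<forall>g'\<in>Mor C V W.
          \<kappa> U V f = \<kappa> U V f' \<longrightarrow> \<kappa> V W g = \<kappa> V W g' \<longrightarrow>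
          \<kappa> U W (Comp C U V W g f) = \<kappa> U W (Comp C U V W g' f')"
        and neq: "\<kappa> U V f \<noteq> \<kappa> U V g"
      using sep[OF f] by (elim exE conjE)
    obtain D where "finite_category D" "is_functor C D id \<kappa>"
      by (rule image_category[of \<kappa>]) (use fin fin_im cong in blast)+
    then show ?thesis using neq True by (intro exI[of _ D] exI[of _ id] exI[of _ \<kappa>]) simp
  next
    case False
    define \<kappa> :: "'o \<Rightarrow> 'o \<Rightarrow> 'a \<Rightarrow> 'c" where "\<kappa> = (\<lambda>_ _ _. undefined)"
    obtain D where "finite_category D" "is_functor C D id \<kappa>"
      by (rule image_category[of \<kappa>]) (use fin in \<open>auto simp: \<kappa>_def image_constant_conv\<close>)
    then show ?thesis using False by (intro exI[of _ D] exI[of _ id] exI[of _ \<kappa>]) auto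
  qed
qed

section \<open>Coordinates on finite-dimensional vector spaces\<close>

text \<open>
  A finite family of vectors \<open>b \<in> B\<close> together with linear functionals \<open>v \<mapsto> c v b\<close> that
  reconstruct each vector; a basis with its dual basis is the example in mind.
\<close>

definition coordinate_system ::
    "('k, 'r) ring_scheme \<Rightarrow> ('k, 'v, 'm) module_scheme \<Rightarrow> 'v set \<Rightarrow> ('v \<Rightarrow> 'v \<Rightarrow> 'k) \<Rightarrow> bool" where
  "coordinate_system K V B c \<longleftrightarrow> finite B \<and> B \<subseteq> carrier V \<and>
    (\<forall>v\<in>carrier V. c v \<in> B \<rightarrow> carrier K \<and> (\<Oplus>\<^bsub>V\<^esub>b\<in>B. c v b \<odot>\<^bsub>V\<^esub> b) = v) \<and>
    (\<forall>v\<in>carrier V. \<forall>w\<in>carrier V. \<forall>b\<in>B. c (v \<oplus>\<^bsub>V\<^esub> w) b = c v b \<oplus>\<^bsub>K\<^esub> c w b) \<and>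
    (\<forall>r\<in>carrier K. \<forall>v\<in>carrier V. \<forall>b\<in>B. c (r \<odot>\<^bsub>V\<^esub> v) b = r \<otimes>\<^bsub>K\<^esub> c v b)"

lemma (in vectorspace) exists_coordinate_system:
  assumes fin_dim
  shows "\<exists>B c. coordinate_system K V B c"
proof -
  obtain B where fin: "finite B" and "basis B" using finite_basis_exists[OF assms] by blast
  then have B: "B \<subseteq> carrier V" by (simp add: basis_def)
  have ex1: "\<exists>!a. a \<in> B \<rightarrow>\<^sub>E carrier K \<and> lincomb a B = v" if "v \<in> carrier V" for v
    using basis_criterion[OF fin B] \<open>basis B\<close> that by blast
  define c where "c v = (THE a. a \<in> B \<rightarrow>\<^sub>E carrier K \<and> lincomb a B = v)" for v
  have c: "c v \<in> B \<rightarrow>\<^sub>E carrier K" "lincomb (c v) B = v" if "v \<in> carrier V" for v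
    using theI'[OF ex1[OF that]] by (auto simp: c_def)
  have c_eq: "c v b = a b" if "a \<in> B \<rightarrow> carrier K" "lincomb a B = v" "b \<in> B" for a b v
  proof -
    have v: "v \<in> carrier V" using that B by auto
    have "lincomb (restrict a B) B = v"
      using that B lincomb_cong[OF refl B, of "restrict a B" a] by simp
    then have "restrict a B = c v"
      using ex1[OF v] c[OF v] that(1) by (metis restrict_PiE)
    then show ?thesis using that(3) by (metis restrict_apply')
  qed
  have c': "c v \<in> B \<rightarrow> carrier K" if "v \<in> carrier V" for v using c(1)[OF that] by auto
  have "c (v \<oplus>\<^bsub>V\<^esub> w) b = c v b \<oplus>\<^bsub>K\<^esub> c w b" if "v \<in> carrier V" "w \<in> carrier V" "b \<in> B" for v w b
    using lincomb_sum[OF fin B c'[OF that(1)] c'[OF that(2)]] c(2) c'[OF that(1)] c'[OF that(2)] that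
    by (intro c_eq) auto
  moreover have "c (r \<odot>\<^bsub>V\<^esub> v) b = r \<otimes>\<^bsub>K\<^esub> c v b" if "r \<in> carrier K" "v \<in> carrier V" "b \<in> B" for r v b
    using lincomb_smult[OF B c'[OF that(2)] that(1)] c(2) c'[OF that(2)] that
    by (intro c_eq) auto
  ultimately have "coordinate_system K V B c"
    using fin B c' c(2) by (simp add: coordinate_system_def lincomb_def)
  then show ?thesis by blast
qed

lemma module_hom_eqI_coordinates:
  assumes "Module.module K V" "Module.module K W" and B: "coordinate_system K V B c"
    and f: "f \<in> LinearCombinations.module_hom K V W" "g \<in> LinearCombinations.module_hom K V W"
    and eq: "\<And>b. b \<in> B \<Longrightarrow> f b = g b" and v: "v \<in> carrier V"
  shows "f v = g v"
proof -
  interpret W: Module.module K W by fact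
  interpret f: mod_hom K V W f using assms by (simp add: mod_hom_def mod_hom_axioms_def)
  interpret g: mod_hom K V W g using assms by (simp add: mod_hom_def mod_hom_axioms_def)
  have c: "B \<subseteq> carrier V" "c v \<in> B \<rightarrow> carrier K" "(\<Oplus>\<^bsub>V\<^esub>b\<in>B. c v b \<odot>\<^bsub>V\<^esub> b) = v"
    using B v by (auto simp: coordinate_system_def)
  have cl: "(\<lambda>b. c v b \<odot>\<^bsub>V\<^esub> b) \<in> B \<rightarrow> carrier V" using c by auto
  have "f v = (\<Oplus>\<^bsub>W\<^esub>b\<in>B. f (c v b \<odot>\<^bsub>V\<^esub> b))" using f.hom_sum[OF c(1) cl] c(3) by simp
  also have "\<dots> = (\<Oplus>\<^bsub>W\<^esub>b\<in>B. g (c v b \<odot>\<^bsub>V\<^esub> b))"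
    using c eq cl by (intro W.M.finsum_cong') (auto simp: Pi_iff subset_iff)
  also have "\<dots> = g v" using g.hom_sum[OF c(1) cl] c(3) by simp
  finally show ?thesis .
qed

lemma coordinate_of_composite:
  assumes "field K" "Module.module K V" "Module.module K W"
    and B: "coordinate_system K V B c" and B': "coordinate_system K W B' c'"
    and g: "g \<in> LinearCombinations.module_hom K V W" and v: "v \<in> carrier V" and d: "d \<in> B'"
  shows "c' (g v) d = (\<Oplus>\<^bsub>K\<^esub>b\<in>B. c v b \<otimes>\<^bsub>K\<^esub> c' (g b) d)"
proof -
  interpret K: field K by fact
  interpret V: Module.module K V by fact
  interpret g: mod_hom K V W g using assms by (simp add: mod_hom_def mod_hom_axioms_def)
  define l where "l v = c' (g v) d" for v
  have l_cl: "l u \<in> carrier K" if "u \<in> carrier V" for u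
    using B' d g.f_im[OF that] by (auto simp: coordinate_system_def l_def)
  have l_add: "l (u \<oplus>\<^bsub>V\<^esub> w) = l u \<oplus>\<^bsub>K\<^esub> l w" if "u \<in> carrier V" "w \<in> carrier V" for u w
    using B' d that by (simp add: coordinate_system_def l_def)
  have l_smult: "l (r \<odot>\<^bsub>V\<^esub> u) = r \<otimes>\<^bsub>K\<^esub> l u" if "r \<in> carrier K" "u \<in> carrier V" for r u
    using B' d that by (simp add: coordinate_system_def l_def)
  have "l \<zero>\<^bsub>V\<^esub> = \<zero>\<^bsub>K\<^esub>"
    using l_smult[of "\<zero>\<^bsub>K\<^esub>" "\<zero>\<^bsub>V\<^esub>"] l_cl[of "\<zero>\<^bsub>V\<^esub>"] by simp
  have sum: "l (\<Oplus>\<^bsub>V\<^esub>b\<in>A. a b \<odot>\<^bsub>V\<^esub> b) = (\<Oplus>\<^bsub>K\<^esub>b\<in>A. a b \<otimes>\<^bsub>K\<^esub> l b)"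
    if "finite A" "A \<subseteq> carrier V" "a \<in> A \<rightarrow> carrier K" for A a
    using that
  proof (induction A rule: finite_induct)
    case empty
    then show ?case using \<open>l \<zero>\<^bsub>V\<^esub> = \<zero>\<^bsub>K\<^esub>\<close> by simp
  next
    case (insert x A)
    have cl: "(\<lambda>b. a b \<odot>\<^bsub>V\<^esub> b) \<in> A \<rightarrow> carrier V" "a x \<odot>\<^bsub>V\<^esub> x \<in> carrier V" "a x \<in> carrier K"
        "(\<lambda>b. a b \<otimes>\<^bsub>K\<^esub> l b) \<in> A \<rightarrow> carrier K" "x \<in> carrier V"
      using insert.prems l_cl by auto
    then show ?case
      using insert by (simp add: l_add l_smult l_cl V.M.finsum_closed)
  qed
  have "l v = (\<Oplus>\<^bsub>K\<^esub>b\<in>B. c v b \<otimes>\<^bsub>K\<^esub> l b)"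
    using sum[of B "c v"] B v by (simp add: coordinate_system_def)
  then show ?thesis by (simp add: l_def)
qed

section \<open>Matrix entries in a subcategory of vector spaces\<close>

lemma subring_hom_finsum:
  assumes "ring K" "ring L" and R: "subring R K" and \<phi>: "\<phi> \<in> ring_hom (K\<lparr>carrier := R\<rparr>) L"
    and "finite A" "f \<in> A \<rightarrow> R"
  shows "finsum K f A \<in> R \<and> \<phi> (finsum K f A) = (\<Oplus>\<^bsub>L\<^esub>a\<in>A. \<phi> (f a))"
proof -
  interpret K: ring K by fact
  interpret L: ring L by fact
  interpret S: ring "K\<lparr>carrier := R\<rparr>" by (rule K.subring_is_ring[OF R])
  have RK: "R \<subseteq> carrier K" by (rule subringE(1)[OF R])
  have \<phi>_cl: "\<phi> a \<in> carrier L" if "a \<in> R" for a using ring_hom_closed[OF \<phi>] that by simp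
  show ?thesis
    using assms(5,6)
  proof (induction A rule: finite_induct)
    case empty
    then show ?case
      using subringE(2)[OF R] ring_hom_zero[OF \<phi> S.ring_axioms L.ring_axioms] by simp
  next
    case (insert x A)
    then have IH: "finsum K f A \<in> R" "\<phi> (finsum K f A) = (\<Oplus>\<^bsub>L\<^esub>a\<in>A. \<phi> (f a))" and x: "f x \<in> R"
      and f: "f \<in> A \<rightarrow> R" by auto
    have "finsum K f (insert x A) = f x \<oplus>\<^bsub>K\<^esub> finsum K f A"
      using insert.hyps f x RK by (intro K.finsum_insert) auto
    moreover have "(\<Oplus>\<^bsub>L\<^esub>a\<in>insert x A. \<phi> (f a)) = \<phi> (f x) \<oplus>\<^bsub>L\<^esub> (\<Oplus>\<^bsub>L\<^esub>a\<in>A. \<phi> (f a))"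
      using insert.hyps f x \<phi>_cl by (intro L.finsum_insert) auto
    moreover have "\<phi> (f x \<oplus>\<^bsub>K\<^esub> finsum K f A) = \<phi> (f x) \<oplus>\<^bsub>L\<^esub> \<phi> (finsum K f A)"
      using ring_hom_add[OF \<phi>, of "f x" "finsum K f A"] x IH(1) by simp
    ultimately show ?case
      using IH subringE(7)[OF R x IH(1)] by simp
  qed
qed

locale linear_subcategory_with_coordinates =
  fixes K :: "('k, 'r) ring_scheme"
    and C :: "(('k, 'v) module, 'v \<Rightarrow> 'v) category"
    and B :: "('k, 'v) module \<Rightarrow> 'v set" and c :: "('k, 'v) module \<Rightarrow> 'v \<Rightarrow> 'v \<Rightarrow> 'k"
  assumes field: "field K" and sub: "subcategory C (fin_dim_vect K)"
    and coords: "V \<in> Ob C \<Longrightarrow> coordinate_system K V (B V) (c V)"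
begin

sublocale category C
  using sub by (simp add: subcategory_def)

sublocale K: field K
  by (rule field)

lemma finite_basis: "V \<in> Ob C \<Longrightarrow> finite (B V)"
  using coords by (simp add: coordinate_system_def)

lemma basis_closed: "V \<in> Ob C \<Longrightarrow> b \<in> B V \<Longrightarrow> b \<in> carrier V"
  using coords[of V] by (auto simp: coordinate_system_def)

lemma Ob_module: "V \<in> Ob C \<Longrightarrow> Module.module K V"
  using sub by (auto simp: subcategory_def fin_dim_vect_def vectorspace_def)

lemma Mor_linear:
  assumes "U \<in> Ob C" "V \<in> Ob C" "f \<in> Mor C U V"
  shows "f \<in> LinearCombinations.module_hom K U V" "f \<in> extensional (carrier U)"
proof -
  have "Mor C U V \<subseteq> Mor (fin_dim_vect K) U V"
    using sub assms(1,2) by (simp add: subcategory_def)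
  with assms(3) show "f \<in> LinearCombinations.module_hom K U V" "f \<in> extensional (carrier U)"
    by (auto simp: fin_dim_vect_def)
qed

lemma Mor_closed:
  assumes "U \<in> Ob C" "V \<in> Ob C" "f \<in> Mor C U V" "v \<in> carrier U"
  shows "f v \<in> carrier V"
  using module_hom_closed[OF Mor_linear(1)[OF assms(1-3)]] assms(4) by auto

text \<open>
  The matrix entry of \<open>f\<close> in column \<open>b\<close> and row \<open>d\<close>, with respect to the coordinates of the
  target \<open>V\<close>.
\<close>

definition entry :: "('k, 'v) module \<Rightarrow> ('v \<Rightarrow> 'v) \<Rightarrow> 'v \<Rightarrow> 'v \<Rightarrow> 'k" where
  "entry V f b d = c V (f b) d"

lemma entry_closed:
  assumes "U \<in> Ob C" "V \<in> Ob C" "f \<in> Mor C U V" "b \<in> B U" "d \<in> B V"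
  shows "entry V f b d \<in> carrier K"
  using coords[OF assms(2)] assms(5) Mor_closed[OF assms(1-3) basis_closed[OF assms(1,4)]]
  by (auto simp: coordinate_system_def entry_def)

lemma entry_Comp:
  assumes "U \<in> Ob C" "V \<in> Ob C" "W \<in> Ob C" "f \<in> Mor C U V" "g \<in> Mor C V W" "b \<in> B U" "d \<in> B W"
  shows "entry W (Comp C U V W g f) b d = (\<Oplus>\<^bsub>K\<^esub>e\<in>B V. entry V f b e \<otimes>\<^bsub>K\<^esub> entry W g e d)"
proof -
  have "Comp C U V W g f = compose (carrier U) g f"
    using sub assms(1-5) by (simp add: subcategory_def fin_dim_vect_def)
  then have "Comp C U V W g f b = g (f b)"
    using basis_closed[OF assms(1,6)] by (simp add: compose_eq)
  then show ?thesis
    using coordinate_of_composite[OF field Ob_module[OF assms(2)] Ob_module[OF assms(3)]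
        coords[OF assms(2)] coords[OF assms(3)] Mor_linear(1)[OF assms(2,3,5)]
        Mor_closed[OF assms(1,2,4) basis_closed[OF assms(1,6)]] assms(7)]
    by (simp add: entry_def)
qed

lemma Mor_eqI_entries:
  assumes UV: "U \<in> Ob C" "V \<in> Ob C" and f: "f \<in> Mor C U V" "g \<in> Mor C U V"
    and eq: "\<And>b d. b \<in> B U \<Longrightarrow> d \<in> B V \<Longrightarrow> entry V f b d = entry V g b d"
  shows "f = g"
proof (rule extensionalityI[OF Mor_linear(2)[OF UV f(1)] Mor_linear(2)[OF UV f(2)]])
  interpret V: Module.module K V by (rule Ob_module[OF UV(2)])
  have "f b = g b" if b: "b \<in> B U" for b
  proof -
    have fb: "f b \<in> carrier V" "g b \<in> carrier V"
      using Mor_closed UV f basis_closed[OF UV(1) b] by auto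
    have cl: "c V v \<in> B V \<rightarrow> carrier K" "(\<Oplus>\<^bsub>V\<^esub>d\<in>B V. c V v d \<odot>\<^bsub>V\<^esub> d) = v" if "v \<in> carrier V" for v
      using coords[OF UV(2)] that by (auto simp: coordinate_system_def)
    have "(\<Oplus>\<^bsub>V\<^esub>d\<in>B V. c V (f b) d \<odot>\<^bsub>V\<^esub> d) = (\<Oplus>\<^bsub>V\<^esub>d\<in>B V. c V (g b) d \<odot>\<^bsub>V\<^esub> d)"
      using eq[OF b] cl(1)[OF fb(2)] basis_closed[OF UV(2)]
      by (intro V.M.finsum_cong') (auto simp: entry_def)
    then show ?thesis using cl(2)[OF fb(1)] cl(2)[OF fb(2)] by simp
  qed
  then show "f v = g v" if "v \<in> carrier U" for v
    using module_hom_eqI_coordinates[OF Ob_module[OF UV(1)] Ob_module[OF UV(2)] coords[OF UV(1)]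
        Mor_linear(1)[OF UV f(1)] Mor_linear(1)[OF UV f(2)] _ that] by blast
qed

lemma entries_in_subring:
  assumes R: "subring R K" and gen: "S \<subseteq> arrows C"
    and id: "\<And>V b d. V \<in> Ob C \<Longrightarrow> b \<in> B V \<Longrightarrow> d \<in> B V \<Longrightarrow> entry V (Ident C V) b d \<in> R"
    and S: "\<And>U V f b d. (U, V, f) \<in> S \<Longrightarrow> b \<in> B U \<Longrightarrow> d \<in> B V \<Longrightarrow> entry V f b d \<in> R"
    and "(U, V, f) \<in> finite_composites C S"
  shows "(U, V, f) \<in> arrows C \<and> (\<forall>b\<in>B U. \<forall>d\<in>B V. entry V f b d \<in> R)"
  using assms(5)
proof (induction U V f rule: finite_composites.induct)
  case (identity U)
  then show ?case using id Ident_in_Mor by (auto simp: arrows_def)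
next
  case (generator U V f)
  then show ?case using S gen by blast
next
  case (composite U V f W g)
  then have UVW: "U \<in> Ob C" "V \<in> Ob C" "W \<in> Ob C" "f \<in> Mor C U V" "g \<in> Mor C V W"
    and ent: "\<And>b d. b \<in> B U \<Longrightarrow> d \<in> B V \<Longrightarrow> entry V f b d \<in> R"
      "\<And>b d. b \<in> B V \<Longrightarrow> d \<in> B W \<Longrightarrow> entry W g b d \<in> R"
    by (auto simp: arrows_def)
  have "entry W (Comp C U V W g f) b d \<in> R" if "b \<in> B U" "d \<in> B W" for b d
  proof -
    have "(\<lambda>e. entry V f b e \<otimes>\<^bsub>K\<^esub> entry W g e d) \<in> B V \<rightarrow> R"
      using ent that subringE(6)[OF R] by auto
    moreover have "id \<in> ring_hom (K\<lparr>carrier := R\<rparr>) K"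
      using subringE(1)[OF R] by (intro ring_hom_memI) auto
    ultimately show ?thesis
      using subring_hom_finsum[OF K.ring_axioms K.ring_axioms R _ finite_basis[OF UVW(2)]]
        entry_Comp[OF UVW that] by auto
  qed
  then show ?case using Comp_in_Mor UVW by (auto simp: arrows_def)
qed

text \<open>
  Two different parallel morphisms differ in a matrix entry, and some homomorphism \<open>\<phi>\<close> on
  \<open>R\<close> with finite image does not kill the difference of these entries. Applying \<open>\<phi>\<close>
  to all matrix entries is a congruence because the entries of a composite are polynomials in
  the entries of its factors, and it has finitely many classes on each Hom-set because the
  image of \<open>\<phi>\<close> is finite.
\<close>

lemma residually_finite_if_entries:
  assumes fin: "finite (Ob C)" and R: "residually_finite_subring K R"
    and ent: "\<And>U V f b d. \<lbrakk>(U, V, f) \<in> arrows C; b \<in> B U; d \<in> B V\<rbrakk> \<Longrightarrow> entry V f b d \<in> R"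
  shows "residually_finite C"
proof (rule residually_finite_if_congruences_separate[OF fin])
  fix U V f g
  assume UV: "U \<in> Ob C" "V \<in> Ob C" and f: "f \<in> Mor C U V" "g \<in> Mor C U V" "f \<noteq> g"
  have sub: "subring R K" using R by (simp add: residually_finite_subring_def)
  have entR: "entry V f b d \<in> R" if "U \<in> Ob C" "V \<in> Ob C" "f \<in> Mor C U V" "b \<in> B U" "d \<in> B V" for U V f b d
    using ent that by (auto simp: arrows_def)
  obtain b d where bd: "b \<in> B U" "d \<in> B V" "entry V f b d \<noteq> entry V g b d"
    using Mor_eqI_entries[OF UV f(1,2)] f(3) by auto
  let ?x = "entry V f b d" and ?y = "entry V g b d"
  have xy: "?x \<in> R" "?y \<in> R" "?x \<in> carrier K" "?y \<in> carrier K"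
    using entR UV f bd entry_closed by auto
  have diff_R: "?x \<ominus>\<^bsub>K\<^esub> ?y \<in> R"
    using xy subringE(5,7)[OF sub] by (simp add: a_minus_def)
  have diff_nz: "?x \<ominus>\<^bsub>K\<^esub> ?y \<noteq> \<zero>\<^bsub>K\<^esub>" using bd(3) xy by simp
  from R[unfolded residually_finite_subring_def, THEN conjunct2, rule_format, OF diff_R diff_nz]
  obtain L :: "((int list \<times> nat) multiset \<Rightarrow> int) ring" and \<phi>
    where L: "algebraically_closed L" and \<phi>: "\<phi> \<in> ring_hom (K\<lparr>carrier := R\<rparr>) L"
      and fin_\<phi>: "finite (\<phi> ` R)" and nz: "\<phi> (?x \<ominus>\<^bsub>K\<^esub> ?y) \<noteq> \<zero>\<^bsub>L\<^esub>"
    by (elim exE conjE)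
  interpret L: algebraically_closed L by fact
  have \<phi>_cl: "\<phi> r \<in> carrier L" if "r \<in> R" for r
    using ring_hom_closed[OF \<phi>] that by simp
  have "\<phi> ?x \<noteq> \<phi> ?y"
  proof
    assume eq: "\<phi> ?x = \<phi> ?y"
    have "(?x \<ominus>\<^bsub>K\<^esub> ?y) \<oplus>\<^bsub>K\<^esub> ?y = ?x"
      using xy by (simp add: a_minus_def K.a_assoc K.l_neg)
    then have "\<phi> (?x \<ominus>\<^bsub>K\<^esub> ?y) \<oplus>\<^bsub>L\<^esub> \<phi> ?y = \<phi> ?x"
      using ring_hom_add[OF \<phi>, of "?x \<ominus>\<^bsub>K\<^esub> ?y" ?y] xy diff_R by simp
    then show False
      using eq nz \<phi>_cl[OF xy(2)] \<phi>_cl[OF diff_R] L.add.right_cancel[of "\<phi> ?y" "\<phi> (?x \<ominus>\<^bsub>K\<^esub> ?y)" "\<zero>\<^bsub>L\<^esub>"] by simp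
  qed
  define \<kappa> where "\<kappa> U V f = (\<lambda>(b, d)\<in>B U \<times> B V. \<phi> (entry V f b d))" for U V f
  have \<kappa>_D: "\<phi> (entry V f b d) = \<phi> (entry V f' b d)" if "\<kappa> U V f = \<kappa> U V f'" "b \<in> B U" "d \<in> B V" for U V f f' b d
    using fun_cong[OF that(1), of "(b, d)"] that(2,3) by (simp add: \<kappa>_def)
  have "finite (\<kappa> U V ` Mor C U V)" if "U \<in> Ob C" "V \<in> Ob C" for U V
  proof (rule finite_subset)
    show "\<kappa> U V ` Mor C U V \<subseteq> B U \<times> B V \<rightarrow>\<^sub>E \<phi> ` R"
      using entR that by (auto simp: \<kappa>_def)
    show "finite (B U \<times> B V \<rightarrow>\<^sub>E \<phi> ` R)"
      using finite_basis that fin_\<phi> by (intro finite_PiE) auto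
  qed
  moreover have "\<kappa> U W (Comp C U V W g f) = \<kappa> U W (Comp C U V W g' f')"
    if UVW: "U \<in> Ob C" "V \<in> Ob C" "W \<in> Ob C" and m: "f \<in> Mor C U V" "f' \<in> Mor C U V"
      "g \<in> Mor C V W" "g' \<in> Mor C V W" and eq: "\<kappa> U V f = \<kappa> U V f'" "\<kappa> V W g = \<kappa> V W g'"
    for U V W f f' g g'
  proof -
    have \<phi>_Comp: "\<phi> (entry W (Comp C U V W g f) b d) =
        (\<Oplus>\<^bsub>L\<^esub>e\<in>B V. \<phi> (entry V f b e) \<otimes>\<^bsub>L\<^esub> \<phi> (entry W g e d))"
      if m: "f \<in> Mor C U V" "g \<in> Mor C V W" and bd: "b \<in> B U" "d \<in> B W" for f g b d
    proof -
      have R': "entry V f b e \<in> R" "entry W g e d \<in> R" if "e \<in> B V" for e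
        using entR UVW m bd that by auto
      have "(\<lambda>e. entry V f b e \<otimes>\<^bsub>K\<^esub> entry W g e d) \<in> B V \<rightarrow> R"
        using R' subringE(6)[OF sub] by auto
      then have "\<phi> (entry W (Comp C U V W g f) b d) =
          (\<Oplus>\<^bsub>L\<^esub>e\<in>B V. \<phi> (entry V f b e \<otimes>\<^bsub>K\<^esub> entry W g e d))"
        using subring_hom_finsum[OF K.ring_axioms L.ring_axioms sub \<phi> finite_basis[OF UVW(2)]]
          entry_Comp[OF UVW m bd] by simp
      also have "\<dots> = (\<Oplus>\<^bsub>L\<^esub>e\<in>B V. \<phi> (entry V f b e) \<otimes>\<^bsub>L\<^esub> \<phi> (entry W g e d))"
        using R' ring_hom_mult[OF \<phi>] \<phi>_cl by (intro L.finsum_cong') auto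
      finally show ?thesis .
    qed
    have "\<phi> (entry W (Comp C U V W g f) b d) = \<phi> (entry W (Comp C U V W g' f') b d)"
      if bd: "b \<in> B U" "d \<in> B W" for b d
      unfolding \<phi>_Comp[OF m(1,3) bd] \<phi>_Comp[OF m(2,4) bd]
      using \<kappa>_D[OF eq(1) bd(1)] \<kappa>_D[OF eq(2) _ bd(2)] entR[OF UVW(1,2) m(2) bd(1)] entR[OF UVW(2,3) m(4) _ bd(2)] \<phi>_cl
      by (intro L.finsum_cong') auto
    then show ?thesis by (auto simp: \<kappa>_def fun_eq_iff)
  qed
  moreover have "\<kappa> U V f \<noteq> \<kappa> U V g"
    using \<kappa>_D[OF _ bd(1,2)] \<open>\<phi> ?x \<noteq> \<phi> ?y\<close> by blast
  ultimately show "\<exists>\<kappa> :: _ \<Rightarrow> _ \<Rightarrow> _ \<Rightarrow> ('v \<times> 'v \<Rightarrow> (int list \<times> nat) multiset \<Rightarrow> int).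
      (\<forall>U\<in>Ob C. \<forall>V\<in>Ob C. finite (\<kappa> U V ` Mor C U V)) \<and>
      (\<forall>U\<in>Ob C. \<forall>V\<in>Ob C. \<forall>W\<in>Ob C. \<forall>f\<in>Mor C U V. \<forall>f'\<in>Mor C U V. \<forall>g\<in>Mor C V W. \<forall>g'\<in>Mor C V W.
        \<kappa> U V f = \<kappa> U V f' \<longrightarrow> \<kappa> V W g = \<kappa> V W g' \<longrightarrow>
        \<kappa> U W (Comp C U V W g f) = \<kappa> U W (Comp C U V W g' f')) \<and>
      \<kappa> U V f \<noteq> \<kappa> U V g"
    by (intro exI[of _ \<kappa>] conjI ballI impI)
qed

end

section \<open>Residual finiteness of finitely generated linear categories\<close>

theorem corollary4p18:
  fixes K :: "('k, 'r) ring_scheme"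
    and C :: "(('k, 'v) module, 'v \<Rightarrow> 'v) category"
  assumes "field K"
    and "subcategory C (fin_dim_vect K)"
    and "finitely_generated_category C"
  shows "residually_finite C"
proof -
  have "\<exists>B c. coordinate_system K V B c" if "V \<in> Ob C" for V
  proof -
    have "vectorspace K V" "vectorspace.fin_dim K V"
      using assms(2) that by (auto simp: subcategory_def fin_dim_vect_def)
    then show ?thesis by (rule vectorspace.exists_coordinate_system)
  qed
  then obtain B c where coords: "\<And>V. V \<in> Ob C \<Longrightarrow> coordinate_system K V (B V) (c V)"
    by metis
  then interpret linear_subcategory_with_coordinates K C B c
    using assms(1,2) by (intro linear_subcategory_with_coordinates.intro)
  obtain S where fin: "finite (Ob C)" "finite S" and S: "S \<subseteq> arrows C" "arrows C \<subseteq> finite_composites C S"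
    using assms(3) by (auto simp: finitely_generated_category_def)
  \<comment> \<open>In an arbitrary coordinate system the entries of an identity need not be \<open>0\<close> and \<open>1\<close>, so they are adjoined as well.\<close>
  define T where "T = S \<union> (\<lambda>V. (V, V, Ident C V)) ` Ob C"
  define A where "A = (\<Union>(U, V, f)\<in>T. (\<lambda>(b, d). entry V f b d) ` (B U \<times> B V))"
  have T: "T \<subseteq> arrows C"
    using S(1) Ident_in_Mor by (auto simp: T_def arrows_def)
  have "finite T" using fin by (simp add: T_def)
  moreover have "finite ((\<lambda>(b, d). entry V f b d) ` (B U \<times> B V))" if "(U, V, f) \<in> T" for U V f
    using T that finite_basis by (auto simp: arrows_def)
  ultimately have "finite A" unfolding A_def by (intro finite_UN_I) auto
  moreover have "A \<subseteq> carrier K"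
    using T entry_closed by (auto simp: A_def arrows_def)
  ultimately obtain R where R: "residually_finite_subring K R" "A \<subseteq> R"
    using K.exists_residually_finite_subring by metis
  have AR: "entry V f b d \<in> R" if "(U, V, f) \<in> T" "b \<in> B U" "d \<in> B V" for U V f b d
    using R(2) that unfolding A_def by force
  show ?thesis
  proof (rule residually_finite_if_entries[OF fin(1) R(1)])
    fix U V f b d
    assume "(U, V, f) \<in> arrows C" and bd: "b \<in> B U" "d \<in> B V"
    then have fc: "(U, V, f) \<in> finite_composites C S" using S(2) by blast
    have "subring R K" using R(1) by (simp add: residually_finite_subring_def)
    moreover have "entry V (Ident C V) b d \<in> R" if "V \<in> Ob C" "b \<in> B V" "d \<in> B V" for V b d
      using that by (intro AR[of V V]) (auto simp: T_def)
    moreover have "entry V f b d \<in> R" if "(U, V, f) \<in> S" "b \<in> B U" "d \<in> B V" for U V f b d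
      using that by (intro AR[of U V]) (auto simp: T_def)
    ultimately show "entry V f b d \<in> R"
      using entries_in_subring[OF _ S(1) _ _ fc] bd by simp
  qed
qed

end
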